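(* There is an algorithm that, on input a formula $\phi$ over the variable set $V=\{x_1,\ldots,x_n\}$, halts in time linear in the length of $\phi$ and either returns that $\phi$ is not a possibility integrity constraint, or alternatively: (i) returns that $\phi$ is affine, or (ii) in case $\phi$ is separable, produces two non-empty disjoint subsets $V_1,V_2\subseteq V$ such that no clause of $\phi$ contains variables from both $V_1$ and $V_2$, or (iii) in case $\phi$ is renamable partially Horn, produces a subset $V^*\subseteq V$ such that the formula $\phi^*$ obtained from $\phi$ by renaming the variables in $V^*$ is partially Horn.
   Context: A clause is a disjunction of literals of pairwise distinct variables; a CNF formula is a conjunction of clauses. An affine formula is a conjunction of clauses each of which is an exclusive OR (sum mod 2) of literals. A formula over $V$ is separable if $V$ can be partitioned into two non-empty disjoint subsets so that no clause contains variables from both subsets. A Horn clause has at most one positive literal. Renaming a set $W$ of variables means replacing every occurrence of $x$ by $\neg x$ and of $\neg x$ by $x$, for $x\in W$. A formula over $V$ is partially Horn if there is a non-empty $V_0\subseteq V$ such that (i) every clause containing only variables from $V_0$ is Horn and (ii) variables of $V_0$ appear only negatively (if at all) in clauses that also contain variables not in $V_0$; it is renamable partially Horn if some of its variables can be renamed so that it becomes partially Horn. A formula is a possibility integrity constraint if it is separable, or renamable partially Horn, or affine. *)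

theory Defs
  imports Main
begin

section \<open>Formulas\<close>

text \<open>
  Variable \<open>x\<^sub>i\<close> is the number \<open>i\<close>, so \<open>V = {1..n}\<close>. A literal is a variable with its sign
  (\<open>True\<close> for positive). A formula is a list of clauses under one connective: \<open>Or\<close> gives a CNF
  formula, \<open>Xor\<close> a conjunction of exclusive ORs. No variable is required to occur.
\<close>

type_synonym literal = "nat \<times> bool"
type_synonym clause = "literal list"

datatype connective = Or | Xor

record formula =
  nvars :: nat
  conn :: connective
  clauses :: "clause list"

definition variables :: "formula \<Rightarrow> nat set" where
  "variables \<phi> = {1..nvars \<phi>}"

definition clause_vars :: "clause \<Rightarrow> nat set" where
  "clause_vars C = fst ` set C"

definition well_formed :: "formula \<Rightarrow> bool" where
  "well_formed \<phi> \<longleftrightarrow> nvars \<phi> \<ge> 1 \<and>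
     (\<forall>C \<in> set (clauses \<phi>). distinct (map fst C) \<and> clause_vars C \<subseteq> variables \<phi>)"

text \<open>Number of clauses plus number of literal occurrences; \<open>nvars\<close> does not contribute.\<close>

definition formula_length :: "formula \<Rightarrow> nat" where
  "formula_length \<phi> = (\<Sum>C\<leftarrow>clauses \<phi>. length C + 1)"

text \<open>
  A clause with at most one literal is the same formula under either connective, so a formula
  all of whose clauses are of this kind is both a CNF formula and an affine one.
\<close>

definition cnf :: "formula \<Rightarrow> bool" where
  "cnf \<phi> \<longleftrightarrow> conn \<phi> = Or \<or> (\<forall>C \<in> set (clauses \<phi>). length C \<le> 1)"

definition affine :: "formula \<Rightarrow> bool" where
  "affine \<phi> \<longleftrightarrow> conn \<phi> = Xor \<or> (\<forall>C \<in> set (clauses \<phi>). length C \<le> 1)"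

definition no_common_clause :: "formula \<Rightarrow> nat set \<Rightarrow> nat set \<Rightarrow> bool" where
  "no_common_clause \<phi> V1 V2 \<longleftrightarrow>
     (\<forall>C \<in> set (clauses \<phi>). clause_vars C \<inter> V1 = {} \<or> clause_vars C \<inter> V2 = {})"

definition separable :: "formula \<Rightarrow> bool" where
  "separable \<phi> \<longleftrightarrow> (\<exists>V1 V2. V1 \<noteq> {} \<and> V2 \<noteq> {} \<and> V1 \<inter> V2 = {} \<and> V1 \<union> V2 = variables \<phi> \<and>
     no_common_clause \<phi> V1 V2)"

definition horn_clause :: "clause \<Rightarrow> bool" where
  "horn_clause C \<longleftrightarrow> length (filter snd C) \<le> 1"

definition partially_horn :: "formula \<Rightarrow> bool" where
  "partially_horn \<phi> \<longleftrightarrow> cnf \<phi> \<and> (\<exists>V0 \<subseteq> variables \<phi>. V0 \<noteq> {} \<and>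
     (\<forall>C \<in> set (clauses \<phi>). clause_vars C \<subseteq> V0 \<longrightarrow> horn_clause C) \<and>
     (\<forall>C \<in> set (clauses \<phi>). \<not> clause_vars C \<subseteq> V0 \<longrightarrow> (\<forall>(x, pos) \<in> set C. x \<in> V0 \<longrightarrow> \<not> pos)))"

definition rename_clause :: "nat set \<Rightarrow> clause \<Rightarrow> clause" where
  "rename_clause W C = map (\<lambda>(x, pos). (x, if x \<in> W then \<not> pos else pos)) C"

definition rename :: "nat set \<Rightarrow> formula \<Rightarrow> formula" where
  "rename W \<phi> = \<phi>\<lparr>clauses := map (rename_clause W) (clauses \<phi>)\<rparr>"

definition renamable_partially_horn :: "formula \<Rightarrow> bool" where
  "renamable_partially_horn \<phi> \<longleftrightarrow> (\<exists>W \<subseteq> variables \<phi>. partially_horn (rename W \<phi>))"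

definition possibility_integrity_constraint :: "formula \<Rightarrow> bool" where
  "possibility_integrity_constraint \<phi> \<longleftrightarrow>
     separable \<phi> \<or> renamable_partially_horn \<phi> \<or> affine \<phi>"

section \<open>Unit-cost random access machine programs\<close>

text \<open>
  A program uses finitely many registers and infinite arrays, all holding natural numbers. The
  only arithmetic is successor and predecessor, so during a run of \<open>t\<close> steps the stored numbers
  grow by at most a constant (depending on the program) times \<open>t\<close>; unit cost therefore hides no
  computation on long words. Expressions and tests are charged one unit irrespective of their
  size, which is bounded by a constant for a fixed program.
\<close>

datatype expr =
    Const nat
  | Reg nat
  | Read nat expr
  | Succ expr
  | Pred expr

datatype test =
    Less expr expr
  | Equal expr expr
  | Neg test
  | Both test test

datatype program =
    Skip
  | Assign nat expr
  | Write nat expr expr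
  | Seq program program
  | Cond test program program
  | Loop test program

record state =
  reg :: "nat \<Rightarrow> nat"
  arr :: "nat \<Rightarrow> nat \<Rightarrow> nat"

fun eval_expr :: "expr \<Rightarrow> state \<Rightarrow> nat" where
  "eval_expr (Const k) s = k"
| "eval_expr (Reg r) s = reg s r"
| "eval_expr (Read a e) s = arr s a (eval_expr e s)"
| "eval_expr (Succ e) s = eval_expr e s + 1"
| "eval_expr (Pred e) s = eval_expr e s - 1"

fun eval_test :: "test \<Rightarrow> state \<Rightarrow> bool" where
  "eval_test (Less e f) s \<longleftrightarrow> eval_expr e s < eval_expr f s"
| "eval_test (Equal e f) s \<longleftrightarrow> eval_expr e s = eval_expr f s"
| "eval_test (Neg b) s \<longleftrightarrow> \<not> eval_test b s"
| "eval_test (Both b c) s \<longleftrightarrow> eval_test b s \<and> eval_test c s"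

definition write_array :: "nat \<Rightarrow> nat \<Rightarrow> nat \<Rightarrow> state \<Rightarrow> state" where
  "write_array a i k s = s\<lparr>arr := (arr s)(a := (arr s a)(i := k))\<rparr>"

text \<open>\<open>runs p s t s'\<close>: started in \<open>s\<close>, the program \<open>p\<close> halts after \<open>t\<close> steps in \<open>s'\<close>.\<close>

inductive runs :: "program \<Rightarrow> state \<Rightarrow> nat \<Rightarrow> state \<Rightarrow> bool" where
  Skip: "runs Skip s 1 s"
| Assign: "runs (Assign r e) s 1 (s\<lparr>reg := (reg s)(r := eval_expr e s)\<rparr>)"
| Write: "runs (Write a e f) s 1 (write_array a (eval_expr e s) (eval_expr f s) s)"
| Seq: "runs p s t s' \<Longrightarrow> runs q s' u s'' \<Longrightarrow> runs (Seq p q) s (t + u) s''"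
| CondTrue: "eval_test b s \<Longrightarrow> runs p s t s' \<Longrightarrow> runs (Cond b p q) s (1 + t) s'"
| CondFalse: "\<not> eval_test b s \<Longrightarrow> runs q s t s' \<Longrightarrow> runs (Cond b p q) s (1 + t) s'"
| LoopFalse: "\<not> eval_test b s \<Longrightarrow> runs (Loop b p) s 1 s"
| LoopTrue: "eval_test b s \<Longrightarrow> runs p s t s' \<Longrightarrow> runs (Loop b p) s' u s'' \<Longrightarrow>
    runs (Loop b p) s (1 + t + u) s''"

lemma runs_deterministic:
  "runs p s t s' \<Longrightarrow> runs p s u s'' \<Longrightarrow> u = t \<and> s'' = s'"
proof (induction arbitrary: u s'' rule: runs.induct)
  case (Seq p s t s' q u' s''')
  from Seq.prems Seq.IH show ?case by (cases rule: runs.cases) blast+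
next
  case (CondTrue b s p t s' q)
  from CondTrue.prems CondTrue.IH CondTrue.hyps show ?case by (cases rule: runs.cases) blast+
next
  case (CondFalse b s q t s' p)
  from CondFalse.prems CondFalse.IH CondFalse.hyps show ?case by (cases rule: runs.cases) blast+
next
  case (LoopTrue b s p t s' u' s''')
  from LoopTrue.prems LoopTrue.IH LoopTrue.hyps show ?case by (cases rule: runs.cases) blast+
qed (auto elim: runs.cases)

section \<open>Input and output\<close>

text \<open>
  The input, in array 0, is \<open>n\<close>, the connective and the number of clauses, then for every clause
  its number of literals followed by its literals, two words each. Everything else is 0.
\<close>

definition encode_literal :: "literal \<Rightarrow> nat list" where
  "encode_literal l = [fst l, if snd l then 1 else 0]"

definition encode_clause :: "clause \<Rightarrow> nat list" where
  "encode_clause C = length C # concat (map encode_literal C)"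

definition encode_formula :: "formula \<Rightarrow> nat list" where
  "encode_formula \<phi> = [nvars \<phi>, case conn \<phi> of Or \<Rightarrow> 0 | Xor \<Rightarrow> 1, length (clauses \<phi>)]
     @ concat (map encode_clause (clauses \<phi>))"

definition initial_state :: "formula \<Rightarrow> state" where
  "initial_state \<phi> = \<lparr>reg = (\<lambda>_. 0),
     arr = (\<lambda>a i. if a = 0 \<and> i < length (encode_formula \<phi>) then encode_formula \<phi> ! i else 0)\<rparr>"

datatype answer =
    Not_PIC
  | Is_Affine
  | Separation "nat set" "nat set"
  | Renaming "nat set"

text \<open>
  Register 0 selects the answer. A set is returned as a list of its elements: those of the set
  number \<open>a\<close> are the first \<open>reg s a\<close> entries of array \<open>a\<close>.
\<close>

definition listed_set :: "state \<Rightarrow> nat \<Rightarrow> nat set" where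
  "listed_set s a = arr s a ` {..<reg s a}"

definition answer_of :: "state \<Rightarrow> answer" where
  "answer_of s =
     (if reg s 0 = 0 then Not_PIC
      else if reg s 0 = 1 then Is_Affine
      else if reg s 0 = 2 then Separation (listed_set s 1) (listed_set s 2)
      else Renaming (listed_set s 1))"

end

theory Submission
  imports Defs
begin

text \<open>
  Draw an edge from a literal \<open>l\<close> to \<open>\<not> l'\<close> whenever \<open>l\<close> and \<open>l'\<close> are distinct literals of a common
  clause. This graph is skew-symmetric. Collecting the literals over \<open>V\<^sub>0\<close> that become positive
  shows that a CNF formula is renamable partially Horn iff some non-empty set of literals is
  consistent (contains no complementary pair) and closed under the edges. By skew symmetry the
  literals reachable from \<open>l\<close> are consistent unless they include \<open>\<not> l\<close>.

  Two searches suffice. Let \<open>R\<close> be the set reached from \<open>x\<^sub>1\<close>. If \<open>R\<close> contains some \<open>l\<close> but not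
  \<open>\<not> l\<close>, then \<open>l\<close> does not reach \<open>\<not> l\<close>; search from \<open>l\<close>. Otherwise search from \<open>\<not> x\<^sub>1\<close>. If that
  reaches \<open>x\<^sub>1\<close> too, then \<open>R\<close> is a strongly connected component closed under negation, and its
  variables form the connected component of \<open>x\<^sub>1\<close>: either some variable lies outside it and the
  formula is separable, or every literal reaches its negation.

  A search is linear although a clause of length \<open>k\<close> contributes \<open>k (k - 1)\<close> edges: after two of its
  literals have been processed, the negations of all its literals have been reached.
\<close>

section \<open>The literal graph\<close>

definition neg :: "literal \<Rightarrow> literal" where
  "neg l = (fst l, \<not> snd l)"

lemma neg_neg [simp]: "neg (neg l) = l"
  and fst_neg [simp]: "fst (neg l) = fst l"
  and snd_neg [simp]: "snd (neg l) \<longleftrightarrow> \<not> snd l"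
  and neg_Pair [simp]: "neg (x, b) = (x, \<not> b)"
  by (simp_all add: neg_def)

lemma neg_neq [simp]: "neg l \<noteq> l" "l \<noteq> neg l"
  by (auto simp: neg_def prod_eq_iff)

text \<open>An edge is a forced choice: if \<open>l\<close> is to become positive with its variable
  in V0, every clause containing \<open>l\<close> must lie over V0 and be Horn, so each other
  literal of that clause becomes negative and its negation positive.\<close>

definition edge :: "clause list \<Rightarrow> literal \<Rightarrow> literal \<Rightarrow> bool" where
  "edge cs l l' \<longleftrightarrow> (\<exists>C \<in> set cs. l \<in> set C \<and> neg l' \<in> set C \<and> neg l' \<noteq> l)"

abbreviation reach :: "clause list \<Rightarrow> literal \<Rightarrow> literal \<Rightarrow> bool" where
  "reach cs \<equiv> (edge cs)\<^sup>*\<^sup>*"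

definition closed_under :: "clause list \<Rightarrow> literal set \<Rightarrow> bool" where
  "closed_under cs P \<longleftrightarrow> (\<forall>l \<in> P. \<forall>l'. edge cs l l' \<longrightarrow> l' \<in> P)"

definition consistent :: "literal set \<Rightarrow> bool" where
  "consistent P \<longleftrightarrow> (\<forall>l \<in> P. neg l \<notin> P)"

definition self_dual :: "literal set \<Rightarrow> bool" where
  "self_dual P \<longleftrightarrow> (\<forall>l \<in> P. neg l \<in> P)"

lemma edge_skew: "edge cs l l' \<Longrightarrow> edge cs (neg l') (neg l)"
  unfolding edge_def by (metis neg_neg)

lemma reach_skew: "reach cs l l' \<Longrightarrow> reach cs (neg l') (neg l)"
  by (induction rule: rtranclp_induct) (auto intro: converse_rtranclp_into_rtranclp edge_skew)

lemma closed_reach: "closed_under cs P \<Longrightarrow> l \<in> P \<Longrightarrow> reach cs l l' \<Longrightarrow> l' \<in> P"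
  by (rotate_tac 2, induction rule: rtranclp_induct) (auto simp: closed_under_def)

lemma reach_closed: "closed_under cs (Collect (reach cs l))"
  by (auto simp: closed_under_def intro: rtranclp.rtrancl_into_rtrancl)

lemma reach_cases: "reach cs l l' \<Longrightarrow> l' = l \<or> (\<exists>C \<in> set cs. neg l' \<in> set C)"
  by (induction rule: rtranclp_induct) (auto simp: edge_def)

text \<open>Suppose \<open>l\<close> reaches both (x, b) and its negation. Reversing the second path
  by skew symmetry leads from (x, b) to \<open>neg l\<close>; joined to the first path it takes
  \<open>l\<close> to \<open>neg l\<close>.\<close>

lemma consistent_reach:
  assumes "\<not> reach cs l (neg l)"
  shows "consistent (Collect (reach cs l))"
  unfolding consistent_def
proof safe
  fix x b
  assume "reach cs l (x, b)" "reach cs l (neg (x, b))"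
  from this(1) reach_skew[OF this(2)] show False
    using assms by (metis neg_neg rtranclp_trans)
qed

subsection \<open>Renamings from closed consistent sets\<close>

lemma variables_rename [simp]: "variables (rename W \<phi>) = variables \<phi>"
  and clauses_rename [simp]: "clauses (rename W \<phi>) = map (rename_clause W) (clauses \<phi>)"
  and conn_rename [simp]: "conn (rename W \<phi>) = conn \<phi>"
  by (simp_all add: variables_def rename_def)

lemma set_rename_clause: "(x, b) \<in> set (rename_clause W C) \<longleftrightarrow> (x, b = (x \<notin> W)) \<in> set C"
  by (cases "x \<in> W"; cases b) (force simp: rename_clause_def)+

lemma clause_vars_rename [simp]: "clause_vars (rename_clause W C) = clause_vars C"
  by (force simp: clause_vars_def rename_clause_def)

lemma length_rename_clause [simp]: "length (rename_clause W C) = length C"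
  by (simp add: rename_clause_def)

lemma distinct_rename_clause: "distinct (map fst C) \<Longrightarrow> distinct (map fst (rename_clause W C))"
  by (simp add: rename_clause_def comp_def case_prod_beta)

lemma cnf_rename [simp]: "cnf (rename W \<phi>) = cnf \<phi>"
  by (simp add: cnf_def)

lemma distinct_length_le_1:
  assumes "distinct xs"
  shows "length xs \<le> 1 \<longleftrightarrow> (\<forall>x \<in> set xs. \<forall>y \<in> set xs. x = y)"
proof
  assume "\<forall>x \<in> set xs. \<forall>y \<in> set xs. x = y"
  then have "card (set xs) \<le> 1"
    by (cases xs) (auto simp: card_le_Suc0_iff_eq)
  with assms show "length xs \<le> 1" by (simp add: distinct_card)
next
  assume "length xs \<le> 1"
  then show "\<forall>x \<in> set xs. \<forall>y \<in> set xs. x = y"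
    by (cases xs) auto
qed

lemma horn_clause_iff:
  assumes "distinct (map fst C)"
  shows "horn_clause C \<longleftrightarrow>
    (\<forall>x y. (x, True) \<in> set C \<longrightarrow> (y, True) \<in> set C \<longrightarrow> x = y)"
proof -
  have "distinct (filter snd C)" using assms by (simp add: distinct_map)
  from distinct_length_le_1[OF this] show ?thesis
    by (auto simp: horn_clause_def)
qed

text \<open>Renaming the variables with a negative literal in \<open>P\<close> makes the literals of
  \<open>P\<close> positive, and the variables of \<open>P\<close> serve as V0. Two positive
  literals of one clause would force each other's negations into \<open>P\<close>, and a clause
  containing a literal of \<open>P\<close> lies wholly over V0 by closure.\<close>

lemma partially_horn_renameI:
  assumes wf: "well_formed \<phi>" and cnf: "cnf \<phi>"
    and P: "P \<noteq> {}" "fst ` P \<subseteq> variables \<phi>" "closed_under (clauses \<phi>) P" "consistent P"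
  shows "partially_horn (rename {x. (x, False) \<in> P} \<phi>)"
proof -
  let ?W = "{x. (x, False) \<in> P}"
  \<comment> \<open>Over V0, a literal that is positive after the renaming was in \<open>P\<close>
    before it: consistency excludes the opposite sign.\<close>
  have pos: "(x, True) \<in> set (rename_clause ?W C) \<Longrightarrow> x \<in> fst ` P \<Longrightarrow>
      \<exists>b. (x, b) \<in> P \<and> (x, b) \<in> set C" for x C
    using P(4) by (auto simp: set_rename_clause consistent_def split: if_splits) (metis (full_types))+
  have dist: "C \<in> set (clauses \<phi>) \<Longrightarrow> distinct (map fst C)" for C
    using wf by (auto simp: well_formed_def)
  have nb: "neg l' \<in> P" if "C \<in> set (clauses \<phi>)" "l \<in> P" "l \<in> set C" "l' \<in> set C" "l' \<noteq> l"
    for C l l'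
    using P(3) that unfolding closed_under_def edge_def by (metis neg_neg)
  show ?thesis unfolding partially_horn_def
  proof (intro conjI exI[of _ "fst ` P"] ballI impI)
    fix C' assume "C' \<in> set (clauses (rename ?W \<phi>))" and sub: "clause_vars C' \<subseteq> fst ` P"
    then obtain C where C: "C \<in> set (clauses \<phi>)" "C' = rename_clause ?W C" by auto
    have "x = y" if xy: "(x, True) \<in> set C'" "(y, True) \<in> set C'" for x y
    proof -
      have "x \<in> fst ` P" "y \<in> fst ` P"
        using sub xy by (force simp: clause_vars_def)+
      then obtain b b' where b: "(x, b) \<in> P" "(x, b) \<in> set C" "(y, b') \<in> P" "(y, b') \<in> set C"
        using xy pos C(2) by meson
      then show "x = y"
        using nb[OF C(1) b(1,2) b(4)] P(4) unfolding consistent_def by blast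
    qed
    then show "horn_clause C'"
      using horn_clause_iff[OF distinct_rename_clause[OF dist[OF C(1)]]] C(2) by blast
  next
    fix C' l assume "C' \<in> set (clauses (rename ?W \<phi>))"
      and nsub: "\<not> clause_vars C' \<subseteq> fst ` P" and l: "l \<in> set C'"
    then obtain C where C: "C \<in> set (clauses \<phi>)" "C' = rename_clause ?W C" by auto
    have "\<not> b" if x: "x \<in> fst ` P" "l = (x, b)" for x b
    proof
      assume "b"
      then have "(x, True) \<in> set (rename_clause ?W C)" using x l C(2) by simp
      then obtain b' where b': "(x, b') \<in> P" "(x, b') \<in> set C"
        using pos x by blast
      from nsub C(2) obtain l' where l': "l' \<in> set C" "fst l' \<notin> fst ` P"
        by (auto simp: clause_vars_def[of C])
      then have "neg l' \<in> P" using nb[OF C(1) b' l'(1)] b'(1) by force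
      then show False using l'(2) by (metis fst_neg image_eqI)
    qed
    then show "case l of (x, pos) \<Rightarrow> x \<in> fst ` P \<longrightarrow> \<not> pos" by (cases l) auto
  qed (use cnf P in auto)
qed

lemma renamable_partially_hornE:
  assumes wf: "well_formed \<phi>" and "renamable_partially_horn \<phi>"
  obtains P where "P \<noteq> {}" "fst ` P \<subseteq> variables \<phi>" "closed_under (clauses \<phi>) P" "consistent P"
proof -
  from assms(2) obtain W where "partially_horn (rename W \<phi>)"
    unfolding renamable_partially_horn_def by blast
  then obtain V0 where V0: "V0 \<subseteq> variables \<phi>" "V0 \<noteq> {}"
    and horn: "\<forall>C \<in> set (clauses \<phi>). clause_vars C \<subseteq> V0 \<longrightarrow> horn_clause (rename_clause W C)"
    and negative: "\<forall>C \<in> set (clauses \<phi>). \<not> clause_vars C \<subseteq> V0 \<longrightarrow>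
      (\<forall>(x, pos) \<in> set (rename_clause W C). x \<in> V0 \<longrightarrow> \<not> pos)"
    unfolding partially_horn_def by (elim conjE exE, simp only: clauses_rename variables_rename)
      (simp add: case_prod_beta)
  \<comment> \<open>The literal of \<open>x\<close> that \<open>W\<close> turns positive is the one
    with sign \<open>x \<notin> W\<close>. There is one such literal per variable of V0, so
    consistency comes for free.\<close>
  define P where "P = (\<lambda>x. (x, x \<notin> W)) ` V0"
  have "l' \<in> P" if e: "l \<in> P" "edge (clauses \<phi>) l l'" for l l'
  proof -
    from e(2) obtain C where C: "C \<in> set (clauses \<phi>)" "l \<in> set C" "neg l' \<in> set C" "neg l' \<noteq> l"
      unfolding edge_def by blast
    obtain x where l: "l = (x, x \<notin> W)" "x \<in> V0" using e(1) P_def by auto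
    have x: "(x, True) \<in> set (rename_clause W C)"
      using C(2) l by (simp add: set_rename_clause)
    have dist: "distinct (map fst C)" using wf C(1) by (auto simp: well_formed_def)
    \<comment> \<open>After the renaming the clause has a positive literal over V0, which condition
      (ii) allows only if all its variables lie in V0.\<close>
    have sub: "clause_vars C \<subseteq> V0"
    proof (rule ccontr)
      assume "\<not> clause_vars C \<subseteq> V0"
      with negative C(1)
      have "\<forall>(x, pos) \<in> set (rename_clause W C). x \<in> V0 \<longrightarrow> \<not> pos" by simp
      from bspec[OF this x] l(2) show False by simp
    qed
    then have "fst l' \<in> V0" using C(3) by (force simp: clause_vars_def)
    moreover have "snd l' \<longleftrightarrow> fst l' \<notin> W"
    proof (rule ccontr)
      \<comment> \<open>Otherwise \<open>neg l'\<close> also becomes positive. The Horn property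
        puts it on the variable of \<open>l\<close>, and since the variables of a clause are
        distinct, \<open>neg l'\<close> would be \<open>l\<close>.\<close>
      assume "\<not> ?thesis"
      then have "(fst l', True) \<in> set (rename_clause W C)"
        using C(3) by (auto simp: set_rename_clause neg_def)
      moreover have "horn_clause (rename_clause W C)" using horn C(1) sub by simp
      ultimately have "fst l' = x"
        using x by (simp add: horn_clause_iff[OF distinct_rename_clause[OF dist]])
      then have "fst (neg l') = fst l" using l by simp
      then show False using C(2-4) dist by (metis distinct_map inj_onD)
    qed
    ultimately show ?thesis by (auto simp: P_def image_iff prod_eq_iff)
  qed
  then have "closed_under (clauses \<phi>) P" by (simp add: closed_under_def)
  moreover have "consistent P" by (auto simp: consistent_def P_def)
  moreover have "P \<noteq> {}" "fst ` P \<subseteq> variables \<phi>" using V0 by (auto simp: P_def)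
  ultimately show thesis using that by blast
qed

subsection \<open>The outcome of the two searches\<close>

lemma reach_variables:
  assumes "well_formed \<phi>" "fst l \<in> variables \<phi>" "reach (clauses \<phi>) l l'"
  shows "fst l' \<in> variables \<phi>"
proof (cases "l' = l")
  case False
  then obtain C where "C \<in> set (clauses \<phi>)" "neg l' \<in> set C"
    using reach_cases[OF assms(3)] by blast
  then show ?thesis using assms(1)
    by (force simp: well_formed_def clause_vars_def)
qed (use assms in simp)

lemma renaming_correct:
  assumes wf: "well_formed \<phi>" and cnf: "cnf \<phi>" and l: "fst l \<in> variables \<phi>"
    and "\<not> reach (clauses \<phi>) l (neg l)"
    and W: "W = {x. reach (clauses \<phi>) l (x, False)}"
  shows "renamable_partially_horn \<phi> \<and> W \<subseteq> variables \<phi> \<and> partially_horn (rename W \<phi>)"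
proof -
  have W: "W = {x. (x, False) \<in> Collect (reach (clauses \<phi>) l)}" using W by simp
  have "partially_horn (rename W \<phi>)"
    unfolding W
  proof (rule partially_horn_renameI[OF wf cnf])
    show "Collect (reach (clauses \<phi>) l) \<noteq> {}" by blast
    show "fst ` Collect (reach (clauses \<phi>) l) \<subseteq> variables \<phi>"
      using reach_variables[OF wf l] by blast
  qed (intro reach_closed consistent_reach assms)+
  moreover have "W \<subseteq> variables \<phi>"
    using reach_variables[OF wf l] unfolding W by force
  ultimately show ?thesis by (auto simp: renamable_partially_horn_def)
qed

text \<open>Each literal of a clause has an edge to the negation of every other one. As
  \<open>R\<close> holds both signs of its variables, one variable of a clause in \<open>R\<close>
  brings in all the others: the variables of \<open>R\<close> are a union of connected
  components.\<close>

lemma no_common_clause_self_dual: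
  assumes "closed_under (clauses \<phi>) R" "self_dual R"
  shows "no_common_clause \<phi> {x. (x, False) \<in> R} (- {x. (x, False) \<in> R})"
  unfolding no_common_clause_def
proof (intro ballI)
  fix C assume C: "C \<in> set (clauses \<phi>)"
  have R: "l \<in> R \<longleftrightarrow> (fst l, False) \<in> R" for l
    using assms(2) unfolding self_dual_def by (metis (full_types) neg_Pair prod.collapse)
  have False if "l \<in> set C" "l' \<in> set C" "(fst l, False) \<in> R" "(fst l', False) \<notin> R" for l l'
  proof -
    have "edge (clauses \<phi>) l (neg l')"
      using that C unfolding edge_def by (metis neg_neg)
    moreover have "l \<in> R" using that R by blast
    ultimately have "neg l' \<in> R" using assms(1) unfolding closed_under_def by blast
    then show False using R[of "neg l'"] that(4) by simp
  qed
  then show "clause_vars C \<inter> {x. (x, False) \<in> R} = {} \<or> clause_vars C \<inter> - {x. (x, False) \<in> R} = {}"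
    unfolding clause_vars_def by blast
qed

text \<open>A single variable outside \<open>V1\<close> is enough as the second set of the answer.
  Separability itself is witnessed by \<open>V1\<close> and its whole complement within the
  variables.\<close>

lemma separation_correct:
  assumes wf: "well_formed \<phi>" and R: "R = Collect (reach (clauses \<phi>) l)"
    and l: "fst l \<in> variables \<phi>" and sd: "self_dual R"
    and y: "y \<in> variables \<phi>" "(y, False) \<notin> R" and V1: "V1 = {x. (x, False) \<in> R}"
  shows "separable \<phi> \<and> V1 \<subseteq> variables \<phi> \<and> {y} \<subseteq> variables \<phi> \<and>
    V1 \<noteq> {} \<and> {y} \<noteq> {} \<and> V1 \<inter> {y} = {} \<and> no_common_clause \<phi> V1 {y}"
proof -
  have sub: "V1 \<subseteq> variables \<phi>"
    using reach_variables[OF wf l] unfolding V1 R by force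
  have "l \<in> R" by (simp add: R)
  then have "neg l \<in> R" using sd by (simp add: self_dual_def)
  with \<open>l \<in> R\<close> have "fst l \<in> V1" unfolding V1 neg_def by (cases l; cases "snd l") auto
  have ncc: "no_common_clause \<phi> V1 (- V1)"
    unfolding V1 by (intro no_common_clause_self_dual sd) (simp add: R reach_closed)
  then have "no_common_clause \<phi> V1 (variables \<phi> - V1)" "no_common_clause \<phi> V1 {y}"
    using y unfolding no_common_clause_def V1 by blast+
  moreover have "separable \<phi>"
    unfolding separable_def
    by (rule exI[of _ V1], rule exI[of _ "variables \<phi> - V1"])
      (use \<open>fst l \<in> V1\<close> sub y calculation V1 in auto)
  ultimately show ?thesis using sub y \<open>fst l \<in> V1\<close> V1 by auto
qed

text \<open>Here \<open>l\<close> reaches every literal over the variables, and skew symmetry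
  together with \<open>bk\<close> leads from each of them back to \<open>l\<close>, so all literals
  are mutually reachable. This defeats the three properties one by one.\<close>

lemma not_pic:
  assumes wf: "well_formed \<phi>" and conn: "conn \<phi> = Or"
    and sd: "self_dual (Collect (reach (clauses \<phi>) l))"
    and bk: "reach (clauses \<phi>) (neg l) l"
    and all: "\<forall>x \<in> variables \<phi>. reach (clauses \<phi>) l (x, False)"
    and l: "fst l \<in> variables \<phi>"
  shows "\<not> possibility_integrity_constraint \<phi>"
proof -
  let ?cs = "clauses \<phi>"
  have R: "reach ?cs l (x, b)" if "x \<in> variables \<phi>" for x b
    using all that sd unfolding self_dual_def by (cases b) force+
  have "\<not> renamable_partially_horn \<phi>"
  proof
    assume "renamable_partially_horn \<phi>"
    then obtain P where P: "P \<noteq> {}" "fst ` P \<subseteq> variables \<phi>" "closed_under ?cs P" "consistent P"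
      using renamable_partially_hornE wf by blast
    then obtain m where m: "m \<in> P" "fst m \<in> variables \<phi>" by blast
    \<comment> \<open>The path from \<open>m\<close> to \<open>neg l\<close>, then \<open>l\<close>,
      then \<open>neg m\<close> puts a complementary pair into the closed set
      \<open>P\<close>.\<close>
    have "reach ?cs l (neg m)" using R[of "fst m" "\<not> snd m"] m by (simp add: neg_def)
    then have "reach ?cs m (neg l)" using reach_skew by fastforce
    also note bk
    also have "reach ?cs l (neg m)" by fact
    finally have "neg m \<in> P" using P(3) m closed_reach by blast
    then show False using P(4) m by (simp add: consistent_def)
  qed
  moreover have "\<not> separable \<phi>"
  proof
    assume "separable \<phi>"
    then obtain V1 V2 where V: "V1 \<noteq> {}" "V2 \<noteq> {}" "V1 \<inter> V2 = {}" "V1 \<union> V2 = variables \<phi>"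
        "no_common_clause \<phi> V1 V2"
      unfolding separable_def by blast
    \<comment> \<open>The variables at both ends of an edge share a clause, so no path leaves the
      side of the separation on which it starts; yet \<open>l\<close> reaches every
      variable.\<close>
    have "closed_under ?cs {l. fst l \<in> U}" if "U = V1 \<or> U = V2" for U
      unfolding closed_under_def
    proof (intro ballI allI impI)
      fix m m' assume "m \<in> {l. fst l \<in> U}" "edge ?cs m m'"
      then obtain C where C: "C \<in> set ?cs" "m \<in> set C" "neg m' \<in> set C" and "fst m \<in> U"
        unfolding edge_def by blast
      then have "fst m \<in> clause_vars C" "fst m' \<in> clause_vars C"
        unfolding clause_vars_def by (metis fst_neg image_eqI)+
      moreover have "fst m' \<in> V1 \<union> V2"
        using C(1) wf V(4) calculation by (auto simp: well_formed_def)
      ultimately show "m' \<in> {l. fst l \<in> U}"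
        using V(5) C(1) \<open>fst m \<in> U\<close> that unfolding no_common_clause_def by blast
    qed
    then have all: "x \<in> U" if "U = V1 \<or> U = V2" "fst l \<in> U" "x \<in> V1 \<union> V2" for U x
      using closed_reach[of ?cs "{l. fst l \<in> U}" l "(x, True)"] R[of x True] V(4) that by simp
    obtain x1 x2 where x: "x1 \<in> V1" "x2 \<in> V2" using V(1,2) by blast
    from l have "fst l \<in> V1 \<union> V2" by (simp add: V(4))
    then consider "fst l \<in> V1" | "fst l \<in> V2" by (elim UnE)
    then show False
    proof cases
      case 1
      then have "x2 \<in> V1" using x by (rule_tac all[of V1]) simp_all
      then show False using x V(3) by blast
    next
      case 2
      then have "x1 \<in> V2" using x by (rule_tac all[of V2]) simp_all
      then show False using x V(3) by blast
    qed
  qed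
  moreover have "\<not> affine \<phi>"
  proof
    assume "affine \<phi>"
    then have short: "\<forall>C \<in> set ?cs. length C \<le> 1"
      using conn by (simp add: affine_def)
    \<comment> \<open>An edge needs two different literals in one clause. Short clauses leave no
      edges at all, whereas self-duality gives a path from \<open>l\<close> to
      \<open>neg l\<close>.\<close>
    have "\<not> edge ?cs a b" for a b
    proof
      assume "edge ?cs a b"
      then obtain C where C: "C \<in> set ?cs" "a \<in> set C" "neg b \<in> set C" "neg b \<noteq> a"
        unfolding edge_def by blast
      from C(1) short have "length C \<le> 1" by blast
      then show False using C(2-4) by (cases C) auto
    qed
    then have no_edge: "edge ?cs = (\<lambda>_ _. False)" by blast
    have "reach ?cs l (neg l)" using sd unfolding self_dual_def by blast
    then have "neg l = l" unfolding no_edge by (cases rule: rtranclp.cases) simp_all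
    then show False by simp
  qed
  ultimately show ?thesis by (simp add: possibility_integrity_constraint_def)
qed

section \<open>Weakest preconditions with a step counter\<close>

text \<open>\<open>T\<close> is the clock on entry, and \<open>Q\<close> sees the clock on exit.
  Time bounds thus become ordinary postconditions that add up along a sequence, and termination is
  part of the claim.\<close>

definition wp :: "program \<Rightarrow> (nat \<Rightarrow> state \<Rightarrow> bool) \<Rightarrow> nat \<Rightarrow> state \<Rightarrow> bool" where
  "wp p Q T s \<longleftrightarrow> (\<exists>t s'. runs p s t s' \<and> Q (T + t) s')"

section \<open>Frame conditions read off the syntax of programs\<close>

fun written_regs :: "program \<Rightarrow> nat set" where
  "written_regs (Assign r e) = {r}"
| "written_regs (Seq p q) = written_regs p \<union> written_regs q"
| "written_regs (Cond b p q) = written_regs p \<union> written_regs q"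
| "written_regs (Loop b p) = written_regs p"
| "written_regs _ = {}"

fun written_arrays :: "program \<Rightarrow> nat set" where
  "written_arrays (Write a e f) = {a}"
| "written_arrays (Seq p q) = written_arrays p \<union> written_arrays q"
| "written_arrays (Cond b p q) = written_arrays p \<union> written_arrays q"
| "written_arrays (Loop b p) = written_arrays p"
| "written_arrays _ = {}"

text \<open>Thanks to this relation, loop invariants need not mention the registers and arrays that
  the body leaves alone; \<open>wp_mono\<close> and \<open>wp_Loop\<close> supply it at every
  use.\<close>

definition framed :: "program \<Rightarrow> state \<Rightarrow> state \<Rightarrow> bool" where
  "framed p s s' \<longleftrightarrow> (\<forall>r. r \<notin> written_regs p \<longrightarrow> reg s' r = reg s r) \<and>
     (\<forall>a. a \<notin> written_arrays p \<longrightarrow> arr s' a = arr s a)"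

lemma framed_refl: "framed p s s"
  by (simp add: framed_def)

lemma framed_Loop_step: "framed (Loop b p) s s' \<Longrightarrow> framed p s' s'' \<Longrightarrow> framed (Loop b p) s s''"
  by (simp add: framed_def)

lemma framed_reg: "framed p s s' \<Longrightarrow> r \<notin> written_regs p \<Longrightarrow> reg s' r = reg s r"
  and framed_arr: "framed p s s' \<Longrightarrow> a \<notin> written_arrays p \<Longrightarrow> arr s' a = arr s a"
  by (simp_all add: framed_def)

lemma runs_framed: "runs p s t s' \<Longrightarrow> framed p s s'"
  by (induction rule: runs.induct) (auto simp: framed_def write_array_def)

lemma wp_mono:
  assumes "wp p Q T s" and "\<And>T' s'. Q T' s' \<Longrightarrow> framed p s s' \<Longrightarrow> Q' T' s'"
  shows "wp p Q' T s"
  using assms runs_framed unfolding wp_def by blast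

text \<open>Determinism of \<open>runs\<close> makes this rule and those for the other constructs
  without a loop equivalences, so the simplifier can execute straight-line code
  symbolically.\<close>

lemma wp_Skip [simp]: "wp Skip Q T s \<longleftrightarrow> Q (T + 1) s"
proof
  assume "wp Skip Q T s"
  then obtain t s' where "runs Skip s t s'" "Q (T + t) s'" unfolding wp_def by blast
  then show "Q (T + 1) s" using runs_deterministic[OF runs.Skip] by blast
next
  assume "Q (T + 1) s"
  then show "wp Skip Q T s" unfolding wp_def using runs.Skip by blast
qed

lemma wp_Assign [simp]:
  "wp (Assign r e) Q T s \<longleftrightarrow> Q (T + 1) (s\<lparr>reg := (reg s)(r := eval_expr e s)\<rparr>)"
proof
  assume "wp (Assign r e) Q T s"
  then obtain t s' where "runs (Assign r e) s t s'" "Q (T + t) s'" unfolding wp_def by blast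
  then show "Q (T + 1) (s\<lparr>reg := (reg s)(r := eval_expr e s)\<rparr>)"
    using runs_deterministic[OF runs.Assign] by blast
next
  assume "Q (T + 1) (s\<lparr>reg := (reg s)(r := eval_expr e s)\<rparr>)"
  then show "wp (Assign r e) Q T s" unfolding wp_def using runs.Assign by blast
qed

lemma wp_Write [simp]:
  "wp (Write a e f) Q T s \<longleftrightarrow> Q (T + 1) (write_array a (eval_expr e s) (eval_expr f s) s)"
proof
  assume "wp (Write a e f) Q T s"
  then obtain t s' where "runs (Write a e f) s t s'" "Q (T + t) s'" unfolding wp_def by blast
  then show "Q (T + 1) (write_array a (eval_expr e s) (eval_expr f s) s)"
    using runs_deterministic[OF runs.Write] by blast
next
  assume "Q (T + 1) (write_array a (eval_expr e s) (eval_expr f s) s)"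
  then show "wp (Write a e f) Q T s" unfolding wp_def using runs.Write by blast
qed

lemma wp_Seq [simp]: "wp (Seq p q) Q T s \<longleftrightarrow> wp p (wp q Q) T s"
proof
  assume "wp (Seq p q) Q T s"
  then obtain t s' where "runs (Seq p q) s t s'" "Q (T + t) s'" unfolding wp_def by blast
  then show "wp p (wp q Q) T s"
    unfolding wp_def by (cases rule: runs.cases) (auto simp: add.assoc)
next
  assume "wp p (wp q Q) T s"
  then show "wp (Seq p q) Q T s"
    unfolding wp_def by (metis runs.Seq add.assoc)
qed

lemma wp_Cond [simp]:
  "wp (Cond b p q) Q T s \<longleftrightarrow> (if eval_test b s then wp p Q (T + 1) s else wp q Q (T + 1) s)"
proof
  assume "wp (Cond b p q) Q T s"
  then obtain t s' where "runs (Cond b p q) s t s'" "Q (T + t) s'" unfolding wp_def by blast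
  then show "if eval_test b s then wp p Q (T + 1) s else wp q Q (T + 1) s"
    unfolding wp_def by (cases rule: runs.cases) (auto simp: add.assoc[symmetric])
next
  assume "if eval_test b s then wp p Q (T + 1) s else wp q Q (T + 1) s"
  then show "wp (Cond b p q) Q T s"
    unfolding wp_def by (metis runs.CondTrue runs.CondFalse add.assoc)
qed

text \<open>The loop terminates because every step increases the counter, which the invariant bounds.\<close>

lemma wp_Loop:
  assumes init: "I T s"
    and bound: "\<And>T' s'. I T' s' \<Longrightarrow> T' \<le> B"
    and body: "\<And>T' s'. I T' s' \<Longrightarrow> framed (Loop b p) s s' \<Longrightarrow> eval_test b s' \<Longrightarrow> wp p I (T' + 1) s'"
    and exit: "\<And>T' s'. I T' s' \<Longrightarrow> framed (Loop b p) s s' \<Longrightarrow> \<not> eval_test b s' \<Longrightarrow> Q (T' + 1) s'"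
  shows "wp (Loop b p) Q T s"
proof -
  have "wp (Loop b p) Q T' s'" if "I T' s'" "framed (Loop b p) s s'" for T' s'
    using that
  proof (induction "B - T'" arbitrary: T' s' rule: less_induct)
    case less
    show ?case
    proof (cases "eval_test b s'")
      case True
      then obtain t s'' where t: "runs p s' t s''" "I (T' + 1 + t) s''"
        using body[OF less.prems] unfolding wp_def by blast
      have "framed (Loop b p) s s''"
        using less.prems(2) runs_framed[OF t(1)] by (rule framed_Loop_step)
      moreover have "B - (T' + 1 + t) < B - T'"
        using bound[OF t(2)] by linarith
      ultimately have "wp (Loop b p) Q (T' + 1 + t) s''"
        using less.hyps t(2) by blast
      then show ?thesis
        using runs.LoopTrue[OF True t(1)] unfolding wp_def by (metis add.assoc)
    next
      case False
      then show ?thesis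
        using runs.LoopFalse exit[OF less.prems] unfolding wp_def by blast
    qed
  qed
  then show ?thesis using init framed_refl by blast
qed

abbreviation (input) seq :: "program \<Rightarrow> program \<Rightarrow> program"  (infixr ";;" 60) where
  "p ;; q \<equiv> Seq p q"

subsection \<open>Sign bits\<close>

definition negate :: "nat \<Rightarrow> program" where
  "negate r = Cond (Equal (Reg r) (Const 0)) (Assign r (Const 1)) (Assign r (Const 0))"

text \<open>A table indexed by literals takes two consecutive arrays, the first for negative literals.\<close>

definition read_signed :: "nat \<Rightarrow> nat \<Rightarrow> expr \<Rightarrow> expr \<Rightarrow> program" where
  "read_signed r a sg ix =
     Cond (Equal sg (Const 0)) (Assign r (Read a ix)) (Assign r (Read (a + 1) ix))"

definition write_signed :: "nat \<Rightarrow> expr \<Rightarrow> expr \<Rightarrow> expr \<Rightarrow> program" where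
  "write_signed a sg ix e = Cond (Equal sg (Const 0)) (Write a ix e) (Write (a + 1) ix e)"

lemma wp_negate [simp]:
  "wp (negate r) Q T s \<longleftrightarrow> Q (T + 2) (s\<lparr>reg := (reg s)(r := of_bool (reg s r = 0))\<rparr>)"
  by (simp add: negate_def)

lemma wp_read_signed [simp]:
  "wp (read_signed r a sg ix) Q T s \<longleftrightarrow>
     Q (T + 2) (s\<lparr>reg := (reg s)(r := arr s (a + of_bool (eval_expr sg s \<noteq> 0)) (eval_expr ix s))\<rparr>)"
  by (simp add: read_signed_def)

lemma wp_write_signed [simp]:
  "wp (write_signed a sg ix e) Q T s \<longleftrightarrow>
     Q (T + 2) (write_array (a + of_bool (eval_expr sg s \<noteq> 0)) (eval_expr ix s) (eval_expr e s) s)"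
  by (simp add: write_signed_def)

lemma written_negate [simp]: "written_regs (negate r) = {r}" "written_arrays (negate r) = {}"
  and written_read_signed [simp]: "written_regs (read_signed r a sg ix) = {r}"
    "written_arrays (read_signed r a sg ix) = {}"
  and written_write_signed [simp]: "written_regs (write_signed a sg ix e) = {}"
    "written_arrays (write_signed a sg ix e) = {a, a + 1}"
  by (auto simp: negate_def read_signed_def write_signed_def)

subsection \<open>Array contents as lists\<close>

text \<open>Zeros past the end agree with the initial memory. A list therefore determines the whole
  array, and appending an entry is one function update.\<close>

definition padded :: "nat list \<Rightarrow> nat \<Rightarrow> nat" where
  "padded xs i = (if i < length xs then xs ! i else 0)"

lemma padded_snoc: "k = length xs \<Longrightarrow> (padded xs)(k := x) = padded (xs @ [x])"
  by (auto simp: padded_def fun_eq_iff nth_append)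

lemma padded_Cons_snoc: "k = length xs \<Longrightarrow> (padded (y # xs))(Suc k := x) = padded (y # xs @ [x])"
  using padded_snoc[of "Suc k" "y # xs"] by simp

lemma padded_drop:
  assumes "drop i xs = x # ys"
  shows "padded xs i = x" "drop (Suc i) xs = ys"
proof -
  have "i < length xs" using assms by (metis drop_all list.discI not_le)
  with assms show "padded xs i = x" "drop (Suc i) xs = ys"
    by (simp_all add: Cons_nth_drop_Suc[symmetric] padded_def)
qed

lemma padded_nil: "padded [] = (\<lambda>_. 0)" and padded_zero: "padded [0] = (\<lambda>_. 0)"
  by (auto simp: padded_def)

section \<open>Reading the input\<close>

abbreviation (input) "r_pos \<equiv> 3 :: nat"
abbreviation (input) "r_clauses \<equiv> 4 :: nat"
abbreviation (input) "r_left \<equiv> 5 :: nat"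
abbreviation (input) "r_occs \<equiv> 6 :: nat"
abbreviation (input) "r_first \<equiv> 7 :: nat"
abbreviation (input) "r_val \<equiv> 8 :: nat"

abbreviation (input) "a_var \<equiv> 3 :: nat"
abbreviation (input) "a_sgn \<equiv> 4 :: nat"
abbreviation (input) "a_clause \<equiv> 5 :: nat"
abbreviation (input) "a_prev \<equiv> 6 :: nat"
abbreviation (input) "a_last \<equiv> 7 :: nat"

text \<open>
  Literal occurrences are numbered from 1, so that 0 can end the chains. A clause is identified
  by the number of its first literal occurrence.
\<close>

definition append_occ :: program where
  "append_occ =
     Assign r_occs (Succ (Reg r_occs)) ;;
     Write a_var (Reg r_occs) (Read 0 (Reg r_pos)) ;;
     Write a_sgn (Reg r_occs) (Read 0 (Succ (Reg r_pos))) ;;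
     Write a_clause (Reg r_occs) (Reg r_first) ;;
     read_signed r_val a_last (Read 0 (Succ (Reg r_pos))) (Read 0 (Reg r_pos)) ;;
     Write a_prev (Reg r_occs) (Reg r_val) ;;
     write_signed a_last (Read 0 (Succ (Reg r_pos))) (Read 0 (Reg r_pos)) (Reg r_occs) ;;
     Assign r_pos (Succ (Succ (Reg r_pos)))"

definition scan_clause :: program where
  "scan_clause = Loop (Less (Const 0) (Reg r_left)) (append_occ ;; Assign r_left (Pred (Reg r_left)))"

definition scan :: program where
  "scan =
     Assign r_pos (Const 3) ;;
     Assign r_clauses (Read 0 (Const 2)) ;;
     Loop (Less (Const 0) (Reg r_clauses))
       (Assign r_left (Read 0 (Reg r_pos)) ;;
        Assign r_pos (Succ (Reg r_pos)) ;;
        Assign r_first (Succ (Reg r_occs)) ;;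
        scan_clause ;;
        Assign r_clauses (Pred (Reg r_clauses)))"

section \<open>The tables built by the scan: occurrences and their chains\<close>

definition lit :: "literal list \<Rightarrow> nat \<Rightarrow> literal" where
  "lit xs j = xs ! (j - 1)"

text \<open>The value 0 stands for the absence of an occurrence. The guard \<open>0 < k\<close> is
  there because truncated subtraction makes \<open>lit xs 0\<close> the first entry.\<close>

definition last_occ :: "literal list \<Rightarrow> nat \<Rightarrow> literal \<Rightarrow> nat \<Rightarrow> bool" where
  "last_occ xs m l k \<longleftrightarrow> k \<le> m \<and> (0 < k \<longrightarrow> lit xs k = l) \<and> (\<forall>j. k < j \<and> j \<le> m \<longrightarrow> lit xs j \<noteq> l)"

text \<open>The occurrences of each literal form a linked list: \<open>a_last\<close> holds its
  latest element and \<open>a_prev\<close> leads to the one before. The leading 0 in the tables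
  fills cell 0, as numbering starts from 1.\<close>

definition scanned :: "literal list \<Rightarrow> nat list \<Rightarrow> state \<Rightarrow> bool" where
  "scanned xs ids s \<longleftrightarrow> length ids = length xs \<and> reg s r_occs = length xs \<and>
     arr s a_var = padded (0 # map fst xs) \<and>
     arr s a_sgn = padded (0 # map (\<lambda>l. of_bool (snd l)) xs) \<and>
     arr s a_clause = padded (0 # ids) \<and>
     (\<forall>x b. last_occ xs (length xs) (x, b) (arr s (a_last + of_bool b) x)) \<and>
     (\<forall>j. 1 \<le> j \<and> j \<le> length xs \<longrightarrow> last_occ xs (j - 1) (lit xs j) (arr s a_prev j))"

lemma lit_append [simp]: "1 \<le> j \<Longrightarrow> j \<le> length xs \<Longrightarrow> lit (xs @ ys) j = lit xs j"
  by (auto simp: lit_def nth_append)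

lemma lit_snoc [simp]: "lit (xs @ [l]) (Suc (length xs)) = l"
  by (simp add: lit_def)

lemma last_occ_append: "m \<le> length xs \<Longrightarrow> last_occ (xs @ ys) m l k \<longleftrightarrow> last_occ xs m l k"
proof -
  assume "m \<le> length xs"
  then have "lit (xs @ ys) j = lit xs j" if "0 < j" "j \<le> m" for j
    using that by simp
  then show ?thesis by (auto simp: last_occ_def)
qed

lemma last_occ_snoc:
  assumes "last_occ xs (length xs) l k"
  shows "last_occ (xs @ [l']) (Suc (length xs)) l (if l = l' then Suc (length xs) else k)"
proof (cases "l = l'")
  case False
  have "last_occ (xs @ [l']) (length xs) l k" using assms by (simp add: last_occ_append)
  with False show ?thesis unfolding last_occ_def by (auto simp: le_Suc_eq)
qed (auto simp: last_occ_def)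

text \<open>The chain head read before it is overwritten is the latest earlier occurrence of the
  same literal, which is what \<open>a_prev\<close> must hold for the new occurrence.\<close>

lemma wp_append_occ:
  assumes sc: "scanned xs ids s" and E: "arr s 0 (reg s r_pos) = fst l"
    "arr s 0 (Suc (reg s r_pos)) = of_bool (snd l)"
  shows "wp append_occ (\<lambda>T' s'. T' = T + 10 \<and> scanned (xs @ [l]) (ids @ [reg s r_first]) s' \<and>
    reg s' r_pos = reg s r_pos + 2) T s"
proof -
  obtain x b where l: "l = (x, b)" by (cases l)
  have sc': "length ids = length xs" "reg s r_occs = length xs"
    "arr s a_var = padded (0 # map fst xs)"
    "arr s a_sgn = padded (0 # map (\<lambda>l. of_bool (snd l)) xs)"
    "arr s a_clause = padded (0 # ids)"
    and head: "\<And>x b. last_occ xs (length xs) (x, b) (arr s (a_last + of_bool b) x)"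
    and prev: "\<And>j. 1 \<le> j \<Longrightarrow> j \<le> length xs \<Longrightarrow> last_occ xs (j - 1) (lit xs j) (arr s a_prev j)"
    using sc by (auto simp: scanned_def)
  have head': "last_occ (xs @ [l]) (Suc (length xs)) (y, c)
      (if y = x \<and> c = b then Suc (length xs) else arr s (a_last + of_bool c) y)" for y c
    using last_occ_snoc[OF head[of y c], of l] by (simp add: l)
  have prev_old: "last_occ (xs @ [l]) (j - 1) (lit xs j) (arr s a_prev j)"
    if "1 \<le> j" "j \<le> length xs" for j
    using prev[OF that] that by (simp add: last_occ_append)
  have prev_new: "last_occ (xs @ [l]) (length xs) l (arr s (a_last + of_bool b) x)"
    using head[of x b] by (simp add: l last_occ_append)
  have new: "last_occ (xs @ [l]) (Suc (length xs)) (x, b) (Suc (length xs))"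
    using head'[of x b] by simp
  have old: "last_occ (xs @ [l]) (Suc (length xs)) (y, c) (arr s (a_last + of_bool c) y)"
    if "(y, c) \<noteq> (x, b)" for y c
    using head'[of y c] that by auto
  show ?thesis
  \<comment> \<open>The sign decides which of the two arrays of chain heads is written.\<close>
  proof (cases b)
    case True
    show ?thesis
      using E new old[of _ False] old[of _ True] prev_old prev_new
      unfolding append_occ_def scanned_def l True
      by (auto simp: write_array_def sc' padded_Cons_snoc all_bool_eq le_Suc_eq)
  next
    case False
    then have False: "b = False" by simp
    show ?thesis
      using E new old[of _ False] old[of _ True] prev_old prev_new
      unfolding append_occ_def scanned_def l False
      by (auto simp: write_array_def sc' padded_Cons_snoc all_bool_eq le_Suc_eq)
  qed
qed

lemma wp_scan_clause:
  assumes sc: "scanned xs ids s" and E: "arr s 0 = padded E"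
    and d: "drop (reg s r_pos) E = concat (map encode_literal C) @ w"
    and n: "reg s r_left = length C"
  shows "wp scan_clause (\<lambda>T' s'. T' \<le> T + 12 * length C + 1 \<and>
    scanned (xs @ C) (ids @ replicate (length C) (reg s r_first)) s' \<and>
    drop (reg s' r_pos) E = w) T s"
proof -
  let ?f = "reg s r_first"
  \<comment> \<open>\<open>P\<close> has been read and \<open>R\<close> is still to come. Each
    literal is charged 12 steps: 10 for \<open>append_occ\<close>, one for the loop test, one for
    the countdown.\<close>
  define I where "I T' s' \<longleftrightarrow> (\<exists>P R. C = P @ R \<and> reg s' r_left = length R \<and>
    scanned (xs @ P) (ids @ replicate (length P) ?f) s' \<and>
    drop (reg s' r_pos) E = concat (map encode_literal R) @ w \<and>
    T' + 12 * length R \<le> T + 12 * length C)" for T' s'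
  show ?thesis
    unfolding scan_clause_def
  proof (rule wp_Loop[where I = I and B = "T + 12 * length C"])
    show "I T s" using assms unfolding I_def by (intro exI[of _ "[]"] exI[of _ C]) simp
  next
    fix T' s' assume "I T' s'" then show "T' \<le> T + 12 * length C" by (auto simp: I_def)
  next
    fix T' s'
    assume I: "I T' s'"
      and fr: "framed (Loop (Less (Const 0) (Reg r_left)) (append_occ ;; Assign r_left (Pred (Reg r_left)))) s s'"
      and "eval_test (Less (Const 0) (Reg r_left)) s'"
    then have "0 < reg s' r_left" by simp
    with I obtain P l R where P: "C = P @ l # R" "reg s' r_left = Suc (length R)"
      "scanned (xs @ P) (ids @ replicate (length P) ?f) s'"
      "drop (reg s' r_pos) E = encode_literal l @ concat (map encode_literal R) @ w"
      "T' + 12 * Suc (length R) \<le> T + 12 * length C"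
      unfolding I_def by (auto simp: gr0_conv_Suc length_Suc_conv)
    have fr': "arr s' 0 = padded E" "reg s' r_first = ?f"
      using fr E by (simp_all add: framed_def append_occ_def)
    have d1: "drop (reg s' r_pos) E = fst l # of_bool (snd l) # concat (map encode_literal R) @ w"
      using P(4) by (simp add: encode_literal_def)
    note d2 = padded_drop[OF d1] padded_drop[OF padded_drop(2)[OF d1]]
    have "wp append_occ (\<lambda>T'' s''. T'' = T' + 1 + 10 \<and>
        scanned ((xs @ P) @ [l]) ((ids @ replicate (length P) ?f) @ [reg s' r_first]) s'' \<and>
        reg s'' r_pos = reg s' r_pos + 2) (T' + 1) s'"
      using d2 fr' by (intro wp_append_occ[OF P(3)]) simp_all
    then show "wp (append_occ ;; Assign r_left (Pred (Reg r_left))) I (T' + 1) s'"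
      unfolding wp_Seq
    proof (rule wp_mono, elim conjE)
      fix T'' s''
      assume T'': "T'' = T' + 1 + 10" and p: "reg s'' r_pos = reg s' r_pos + 2"
        and sc: "scanned ((xs @ P) @ [l]) ((ids @ replicate (length P) ?f) @ [reg s' r_first]) s''"
        and fr: "framed append_occ s' s''"
      have left: "reg s'' r_left = reg s' r_left" using fr by (simp add: framed_def append_occ_def)
      have "scanned (xs @ (P @ [l])) (ids @ replicate (length (P @ [l])) ?f)
          (s''\<lparr>reg := (reg s'')(r_left := length R)\<rparr>)"
        using sc by (simp add: fr'(2) scanned_def replicate_append_same)
      then show "wp (Assign r_left (Pred (Reg r_left))) I T'' s''"
        unfolding wp_Assign I_def using P d2 T''
        by (intro exI[of _ "P @ [l]"] exI[of _ R]) (simp add: left p)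
    qed
  next
    fix T' s'
    assume "I T' s'" "\<not> eval_test (Less (Const 0) (Reg r_left)) s'"
    then show "T' + 1 \<le> T + 12 * length C + 1 \<and>
      scanned (xs @ C) (ids @ replicate (length C) ?f) s' \<and> drop (reg s' r_pos) E = w"
      by (auto simp: I_def)
  qed
qed

text \<open>An empty clause yields no entry and does not advance the number, so the number of a
  non-empty clause is the position of its first occurrence.\<close>

fun clause_ids :: "nat \<Rightarrow> clause list \<Rightarrow> nat list" where
  "clause_ids f [] = []"
| "clause_ids f (C # cs) = replicate (length C) f @ clause_ids (f + length C) cs"

lemma clause_ids_snoc:
  "clause_ids f (cs @ [C]) = clause_ids f cs @ replicate (length C) (f + length (concat cs))"
  by (induction cs arbitrary: f) (simp_all add: add.assoc)

lemma wp_scan: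
  assumes E: "arr s 0 = padded E" "padded E 2 = length cs"
    and d: "drop 3 E = concat (map encode_clause cs)"
    and z: "reg s r_occs = 0" "\<And>a. a \<noteq> 0 \<Longrightarrow> arr s a = (\<lambda>_. 0)"
  defines "N \<equiv> (\<Sum>C\<leftarrow>cs. length C + 1)"
  shows "wp scan (\<lambda>T' s'. T' \<le> T + 12 * N + 3 \<and> scanned (concat cs) (clause_ids 1 cs) s') T s"
proof -
  let ?s = "s\<lparr>reg := (reg s)(r_pos := 3, r_clauses := length cs)\<rparr>"
  \<comment> \<open>Besides its literals a clause costs 6 steps, covered by the 12 that its own unit
    in the length pays for. The 2 stands for the assignments before the loop.\<close>
  define I where "I T' s' \<longleftrightarrow> (\<exists>D R. cs = D @ R \<and> reg s' r_clauses = length R \<and>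
    scanned (concat D) (clause_ids 1 D) s' \<and>
    drop (reg s' r_pos) E = concat (map encode_clause R) \<and>
    T' + 12 * (\<Sum>C\<leftarrow>R. length C + 1) \<le> T + 2 + 12 * N)" for T' s'
  let ?body = "Assign r_left (Read 0 (Reg r_pos)) ;; Assign r_pos (Succ (Reg r_pos)) ;;
    Assign r_first (Succ (Reg r_occs)) ;; scan_clause ;; Assign r_clauses (Pred (Reg r_clauses))"
  let ?b = "Less (Const 0) (Reg r_clauses)"
  have "wp (Loop ?b ?body) (\<lambda>T' s'. T' \<le> T + 12 * N + 3 \<and> scanned (concat cs) (clause_ids 1 cs) s')
      (T + 2) ?s"
  proof (rule wp_Loop[where I = I and B = "T + 2 + 12 * N"])
    have "scanned [] [] ?s"
      using z by (auto simp: scanned_def padded_zero last_occ_def)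
    then show "I (T + 2) ?s"
      unfolding I_def N_def using d by (intro exI[of _ "[]"] exI[of _ cs]) simp
  next
    fix T' s' assume "I T' s'" then show "T' \<le> T + 2 + 12 * N" by (auto simp: I_def)
  next
    fix T' s'
    assume I: "I T' s'" and fr: "framed (Loop ?b ?body) ?s s'" and "eval_test ?b s'"
    then have "0 < reg s' r_clauses" by simp
    with I obtain D C R where D: "cs = D @ C # R" "reg s' r_clauses = Suc (length R)"
      "scanned (concat D) (clause_ids 1 D) s'"
      "drop (reg s' r_pos) E = encode_clause C @ concat (map encode_clause R)"
      "T' + 12 * (\<Sum>C\<leftarrow>C # R. length C + 1) \<le> T + 2 + 12 * N"
      unfolding I_def by (auto simp: gr0_conv_Suc length_Suc_conv)
    have arr0: "arr s' 0 = padded E"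
      using fr E by (simp add: framed_def scan_clause_def append_occ_def)
    have d1: "drop (reg s' r_pos) E = length C # concat (map encode_literal C) @
        concat (map encode_clause R)"
      using D(4) by (simp add: encode_clause_def)
    note d2 = padded_drop[OF d1]
    have occs: "reg s' r_occs = length (concat D)" using D(3) by (simp add: scanned_def)
    let ?s1 = "s'\<lparr>reg := (reg s')(r_left := length C, r_pos := Suc (reg s' r_pos),
      r_first := Suc (reg s' r_occs))\<rparr>"
    have "scanned (concat D) (clause_ids 1 D) ?s1"
      using D(3) by (simp add: scanned_def)
    then have "wp scan_clause (\<lambda>T'' s''. T'' \<le> (T' + 1 + 1 + 1 + 1) + 12 * length C + 1 \<and>
        scanned (concat D @ C) (clause_ids 1 D @ replicate (length C) (reg ?s1 r_first)) s'' \<and>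
        drop (reg s'' r_pos) E = concat (map encode_clause R)) (T' + 1 + 1 + 1 + 1) ?s1"
      using arr0 d2 by (intro wp_scan_clause) simp_all
    then have "wp scan_clause (wp (Assign r_clauses (Pred (Reg r_clauses))) I) (T' + 1 + 1 + 1 + 1) ?s1"
    proof (rule wp_mono, elim conjE)
      fix T'' s''
      assume T'': "T'' \<le> (T' + 1 + 1 + 1 + 1) + 12 * length C + 1"
        and sc: "scanned (concat D @ C) (clause_ids 1 D @ replicate (length C) (reg ?s1 r_first)) s''"
        and p: "drop (reg s'' r_pos) E = concat (map encode_clause R)"
        and fr: "framed scan_clause ?s1 s''"
      have rest: "reg s'' r_clauses = reg s' r_clauses"
        using fr by (simp add: framed_def scan_clause_def append_occ_def)
      have "scanned (concat (D @ [C])) (clause_ids 1 (D @ [C]))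
          (s''\<lparr>reg := (reg s'')(r_clauses := length R)\<rparr>)"
        using sc by (simp add: clause_ids_snoc occs scanned_def)
      then show "wp (Assign r_clauses (Pred (Reg r_clauses))) I T'' s''"
        unfolding wp_Assign I_def using D p T''
        by (intro exI[of _ "D @ [C]"] exI[of _ R]) (simp add: rest)
    qed
    then show "wp ?body I (T' + 1) s'"
      using d2 arr0 by (simp add: fun_upd_twist)
  next
    fix T' s'
    assume "I T' s'" "\<not> eval_test ?b s'"
    then show "T' + 1 \<le> T + 12 * N + 3 \<and> scanned (concat cs) (clause_ids 1 cs) s'"
      by (auto simp: I_def)
  qed
  then show ?thesis using E by (simp add: scan_def)
qed

section \<open>Clauses as blocks of occurrences\<close>

abbreviation occ_clause :: "clause list \<Rightarrow> nat \<Rightarrow> nat" where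
  "occ_clause cs \<equiv> padded (0 # clause_ids 1 cs)"

definition block :: "clause list \<Rightarrow> nat \<Rightarrow> nat set" where
  "block cs c = {j \<in> {1..length (concat cs)}. occ_clause cs j = c}"

lemma length_clause_ids [simp]: "length (clause_ids f cs) = length (concat cs)"
  by (induction cs arbitrary: f) auto

lemma clause_ids_append:
  "clause_ids f (cs @ ds) = clause_ids f cs @ clause_ids (f + length (concat cs)) ds"
  by (induction cs arbitrary: f) (simp_all add: add.assoc)

lemma clause_ids_bounds: "x \<in> set (clause_ids f cs) \<Longrightarrow> f \<le> x \<and> x < f + length (concat cs)"
  by (induction cs arbitrary: f) (fastforce split: if_splits)+

text \<open>Numbers before the block of \<open>C\<close> are smaller than its own and numbers after
  it are larger; the latter is strict because \<open>C\<close> is non-empty.\<close>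

lemma clause_ids_nth_iff:
  assumes "C \<noteq> []" "j < length (concat (D @ C # R))"
  shows "clause_ids f (D @ C # R) ! j = f + length (concat D) \<longleftrightarrow>
    length (concat D) \<le> j \<and> j < length (concat D) + length C"
proof -
  let ?d = "length (concat D)"
  have ids: "clause_ids f (D @ C # R) = clause_ids f D @ replicate (length C) (f + ?d) @
      clause_ids (f + ?d + length C) R"
    by (simp add: clause_ids_append)
  consider "j < ?d" | "?d \<le> j" "j < ?d + length C" | "?d + length C \<le> j" by linarith
  then show ?thesis
  proof cases
    case 1
    then have "clause_ids f D ! j < f + ?d"
      using clause_ids_bounds nth_mem length_clause_ids by metis
    then show ?thesis using 1 by (simp add: ids nth_append)
  next
    case 2
    then obtain k where "j = ?d + k" "k < length C"
      by (metis le_Suc_ex add_less_cancel_left)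
    then show ?thesis by (simp add: ids nth_append)
  next
    case 3
    then have "j - ?d - length C < length (clause_ids (f + ?d + length C) R)"
      using assms(2) by simp
    then have "f + ?d + length C \<le> clause_ids (f + ?d + length C) R ! (j - ?d - length C)"
      using clause_ids_bounds nth_mem by metis
    moreover have "\<not> j - ?d < length C" "0 < length C" using 3 assms(1) by auto
    ultimately have "clause_ids (f + ?d + length C) R ! (j - ?d - length C) \<noteq> f + ?d" by linarith
    then show ?thesis using 3 \<open>\<not> j - ?d < length C\<close> by (simp add: ids nth_append)
  qed
qed

text \<open>No bound on \<open>j\<close> is assumed: cell 0 and the cells past the last occurrence
  hold 0, which is never a clause number. A sweep over a block thus stops by itself even in the last
  clause.\<close>

lemma occ_clause_iff:
  assumes "C \<noteq> []"
  shows "occ_clause (D @ C # R) j = 1 + length (concat D) \<longleftrightarrow>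
    1 + length (concat D) \<le> j \<and> j < 1 + length (concat D) + length C"
proof (cases "1 \<le> j \<and> j \<le> length (concat (D @ C # R))")
  case True
  then obtain k where k: "j = Suc k" "k < length (concat (D @ C # R))"
    by (cases j) auto
  have "occ_clause (D @ C # R) j = clause_ids 1 (D @ C # R) ! k"
    using k by (simp add: padded_def)
  then show ?thesis
    using clause_ids_nth_iff[OF assms k(2), of 1] k(1) by simp
next
  case False
  then show ?thesis by (cases j) (auto simp: padded_def)
qed

lemma occ_decomp:
  assumes "j < length (concat cs)"
  obtains D C R i where "cs = D @ C # R" "i < length C" "j = length (concat D) + i"
  using assms
proof (induction cs arbitrary: j thesis)
  case (Cons C cs)
  show ?case
  proof (cases "j < length C")
    case True
    then show ?thesis using Cons.prems(1)[of "[]" C cs j] by simp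
  next
    case False
    then have "j - length C < length (concat cs)" using Cons.prems(2) by simp
    then obtain D C' R i where "cs = D @ C' # R" "i < length C'" "j - length C = length (concat D) + i"
      using Cons.IH by blast
    then show ?thesis using Cons.prems(1)[of "C # D" C' R i] False by simp
  qed
qed simp

text \<open>The number of a clause doubles as the address at which its block begins, so a sweep
  needs neither a stored start nor a stored length.\<close>

lemma block_interval:
  assumes "1 \<le> k" "k \<le> length (concat cs)"
  shows "1 \<le> occ_clause cs k"
    and "\<exists>n. \<forall>j. occ_clause cs j = occ_clause cs k \<longleftrightarrow> occ_clause cs k \<le> j \<and> j < occ_clause cs k + n"
proof -
  have "k - 1 < length (concat cs)" using assms by linarith
  then obtain D C R i where D: "cs = D @ C # R" "i < length C" "k - 1 = length (concat D) + i"
    by (rule occ_decomp)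
  then have C: "C \<noteq> []" by auto
  have eq: "occ_clause cs k = 1 + length (concat D)"
    unfolding D(1) occ_clause_iff[OF C] using assms(1) D(2,3) by linarith
  then show "1 \<le> occ_clause cs k" by simp
  show "\<exists>n. \<forall>j. occ_clause cs j = occ_clause cs k \<longleftrightarrow> occ_clause cs k \<le> j \<and> j < occ_clause cs k + n"
    unfolding eq by (rule exI[of _ "length C"]) (unfold D(1) occ_clause_iff[OF C], simp)
qed

text \<open>In clauses without repetition, different literals of a clause are the same as different
  positions of a block. This turns the condition \<open>neg l' \<noteq> l\<close> into
  \<open>i \<noteq> j\<close>.\<close>

lemma edge_iff_occ:
  assumes "\<forall>C \<in> set cs. distinct C"
  shows "edge cs l l' \<longleftrightarrow> (\<exists>i \<in> {1..length (concat cs)}. \<exists>j \<in> {1..length (concat cs)}.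
    occ_clause cs i = occ_clause cs j \<and> i \<noteq> j \<and> lit (concat cs) i = l \<and> lit (concat cs) j = neg l')"
    (is "_ \<longleftrightarrow> ?R")
proof
  have occ: "lit (concat (D @ C # R)) (Suc (length (concat D)) + i) = C ! i"
    "Suc (length (concat D)) + i \<in> {1..length (concat (D @ C # R))}"
    "occ_clause (D @ C # R) (Suc (length (concat D)) + i) = 1 + length (concat D)"
    if "i < length C" for D C R i
  proof -
    show "occ_clause (D @ C # R) (Suc (length (concat D)) + i) = 1 + length (concat D)"
      by (subst occ_clause_iff) (use that in auto)
  qed (use that in \<open>simp_all add: lit_def nth_append\<close>)
  assume "edge cs l l'"
  then obtain C where C: "C \<in> set cs" "l \<in> set C" "neg l' \<in> set C" "neg l' \<noteq> l"
    unfolding edge_def by blast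
  then obtain D R where D: "cs = D @ C # R" by (meson split_list)
  obtain i j where i: "i < length C" "C ! i = l" and j: "j < length C" "C ! j = neg l'"
    using C by (metis in_set_conv_nth)
  have "i \<noteq> j" using i j C(4) by auto
  then show ?R
    unfolding D
    using occ[OF i(1), of D R] occ[OF j(1), of D R]
    by (intro bexI[of _ "Suc (length (concat D)) + i"] bexI[of _ "Suc (length (concat D)) + j"])
      (simp_all add: i j del: concat.simps concat_append)
next
  assume ?R
  then obtain a b where ab: "a \<in> {1..length (concat cs)}" "b \<in> {1..length (concat cs)}"
    "occ_clause cs a = occ_clause cs b" "a \<noteq> b" "lit (concat cs) a = l" "lit (concat cs) b = neg l'"
    by blast
  then have "a - 1 < length (concat cs)" by auto
  then obtain D C R i where D: "cs = D @ C # R" "i < length C" "a - 1 = length (concat D) + i"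
    by (rule occ_decomp)
  then have C: "C \<noteq> []" by auto
  have a: "a = 1 + length (concat D) + i" using ab(1) D(3) by auto
  then have "occ_clause cs a = 1 + length (concat D)"
    unfolding D(1) by (subst occ_clause_iff[OF C]) (use D(2) in auto)
  then have "occ_clause (D @ C # R) b = 1 + length (concat D)" using ab(3) D(1) by simp
  then have "1 + length (concat D) \<le> b" "b < 1 + length (concat D) + length C"
    unfolding occ_clause_iff[OF C] by simp_all
  then obtain j where j: "b = 1 + length (concat D) + j" "j < length C"
    by (metis le_Suc_ex add_less_cancel_left)
  have "C ! i = l" "C ! j = neg l'"
    using ab(5,6) a j D(1,2) by (simp_all add: lit_def nth_append)
  moreover have "C ! i \<noteq> C ! j"
    using assms D(1,2) j ab(4) a by (simp add: nth_eq_iff_index_eq)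
  ultimately show "edge cs l l'"
    unfolding edge_def using D(1,2) j(2) by (intro bexI[of _ C]) (metis nth_mem, simp)
qed

section \<open>Graph search\<close>

abbreviation (input) "r_head \<equiv> 9 :: nat"
abbreviation (input) "r_tail \<equiv> 10 :: nat"
abbreviation (input) "r_occ \<equiv> 11 :: nat"
abbreviation (input) "r_clause \<equiv> 12 :: nat"
abbreviation (input) "r_ix \<equiv> 13 :: nat"
abbreviation (input) "r_var \<equiv> 14 :: nat"
abbreviation (input) "r_sgn \<equiv> 15 :: nat"

text \<open>
  A search owns the arrays from \<open>B\<close> on: variables and signs of the queue, the number of
  traversals of each clause, and the marks of negative and positive literals.
\<close>

definition push :: "nat \<Rightarrow> program" where
  "push B =
     read_signed r_val (B + 3) (Reg r_sgn) (Reg r_var) ;;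
     Cond (Equal (Reg r_val) (Const 0))
       (write_signed (B + 3) (Reg r_sgn) (Reg r_var) (Const 1) ;;
        Write B (Reg r_tail) (Reg r_var) ;;
        Write (B + 1) (Reg r_tail) (Reg r_sgn) ;;
        Assign r_tail (Succ (Reg r_tail)))
       Skip"

definition push_rest :: "nat \<Rightarrow> program" where
  "push_rest B =
     Loop (Equal (Read a_clause (Reg r_ix)) (Reg r_clause))
       (Cond (Equal (Reg r_ix) (Reg r_occ))
          Skip
          (Assign r_var (Read a_var (Reg r_ix)) ;;
           Assign r_sgn (Read a_sgn (Reg r_ix)) ;;
           negate r_sgn ;;
           push B) ;;
        Assign r_ix (Succ (Reg r_ix)))"

text \<open>
  Two traversals of a clause push the negations of all its literals, so later ones are skipped.
\<close>

definition visit :: "nat \<Rightarrow> program" where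
  "visit B =
     Assign r_clause (Read a_clause (Reg r_occ)) ;;
     Cond (Less (Read (B + 2) (Reg r_clause)) (Const 2))
       (Write (B + 2) (Reg r_clause) (Succ (Read (B + 2) (Reg r_clause))) ;;
        Assign r_ix (Reg r_clause) ;;
        push_rest B)
       Skip ;;
     Assign r_occ (Read a_prev (Reg r_occ))"

definition search :: "nat \<Rightarrow> program" where
  "search B =
     Assign r_tail (Const 0) ;;
     push B ;;
     Assign r_head (Const 0) ;;
     Loop (Less (Reg r_head) (Reg r_tail))
       (read_signed r_occ a_last (Read (B + 1) (Reg r_head)) (Read B (Reg r_head)) ;;
        Loop (Less (Const 0) (Reg r_occ)) (visit B) ;;
        Assign r_head (Succ (Reg r_head)))"

lemma written_search [simp]:
  "written_regs (push B) = {r_val, r_tail}"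
  "written_arrays (push B) = {B, B + 1, B + 3, B + 4}"
  "written_regs (push_rest B) = {r_val, r_tail, r_ix, r_var, r_sgn}"
  "written_arrays (push_rest B) = {B, B + 1, B + 3, B + 4}"
  "written_regs (visit B) = {r_val, r_tail, r_ix, r_var, r_sgn, r_clause, r_occ}"
  "written_arrays (visit B) = {B, B + 1, B + 2, B + 3, B + 4}"
  "written_regs (search B) = {r_val, r_tail, r_ix, r_var, r_sgn, r_clause, r_occ, r_head}"
  "written_arrays (search B) = {B, B + 1, B + 2, B + 3, B + 4}"
  by (auto simp: push_def push_rest_def visit_def search_def)

section \<open>Invariants and step counts of a search\<close>

lemma scanned_framed:
  assumes "framed p s s'" "r_occs \<notin> written_regs p" "written_arrays p \<inter> {3..8} = {}"
    and "scanned xs ids s"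
  shows "scanned xs ids s'"
proof -
  have "arr s' a = arr s a" if "a \<in> {3..8}" for a
    using assms(1,3) that by (intro framed_arr) auto
  then have "arr s' 3 = arr s 3" "arr s' 4 = arr s 4" "arr s' 5 = arr s 5" "arr s' 6 = arr s 6"
    "\<And>b. arr s' (7 + of_bool b) = arr s (7 + of_bool b)"
    by (auto simp: of_bool_def)
  then show ?thesis
    using assms(4) framed_reg[OF assms(1,2)] by (simp add: scanned_def)
qed

text \<open>Entries are never removed: the list holds every literal reached so far,
  \<open>r_head\<close> separates the processed ones from the pending ones, and the mark arrays are
  its characteristic function.\<close>

definition queue :: "nat \<Rightarrow> literal list \<Rightarrow> state \<Rightarrow> bool" where
  "queue B q s \<longleftrightarrow> distinct q \<and> reg s r_tail = length q \<and> arr s B = padded (map fst q) \<and>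
     arr s (B + 1) = padded (map (\<lambda>l. of_bool (snd l)) q) \<and>
     (\<forall>x b. arr s (B + 3 + of_bool b) x = of_bool ((x, b) \<in> set q))"

lemma queue_cong:
  assumes "reg s' r_tail = reg s r_tail" "\<And>a. a \<in> {B, B + 1, B + 3, B + 4} \<Longrightarrow> arr s' a = arr s a"
    and "queue B q s"
  shows "queue B q s'"
proof -
  have "arr s' (B + 3 + of_bool b) = arr s (B + 3 + of_bool b)" for b
    using assms(2)[of "B + 3"] assms(2)[of "B + 4"] by (cases b) (simp_all add: add.commute)
  then show ?thesis using assms by (simp add: queue_def)
qed

lemma wp_push:
  assumes q: "queue B q s" and l: "reg s r_var = fst l" "reg s r_sgn = of_bool (snd l)"
  shows "wp (push B) (\<lambda>T' s'. T' \<le> T + 8 \<and> queue B (if l \<in> set q then q else q @ [l]) s') T s"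
proof -
  obtain x b where xb: "l = (x, b)" by (cases l)
  have tail: "reg s r_tail = length q" and mark: "\<And>y c. arr s (B + 3 + of_bool c) y = of_bool ((y, c) \<in> set q)"
    and Q: "arr s B = padded (map fst q)" "arr s (B + 1) = padded (map (\<lambda>l. of_bool (snd l)) q)"
    and "distinct q"
    using q by (simp_all add: queue_def)
  show ?thesis
  proof (cases "l \<in> set q")
    case True
    have "queue B q (s\<lparr>reg := (reg s)(r_val := 1)\<rparr>)"
      using q by (simp add: queue_def)
    then show ?thesis
      using True mark[of b x] l xb unfolding push_def by (simp add: add.commute)
  next
    case False
    let ?s = "write_array (B + 1) (length q) (of_bool b) (write_array B (length q) x
      (write_array (B + 3 + of_bool b) x 1 (s\<lparr>reg := (reg s)(r_val := 0)\<rparr>)))"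
    let ?s' = "?s\<lparr>reg := (reg ?s)(r_tail := Suc (length q))\<rparr>"
    have "(padded (map fst q))(length q := x) = padded (map fst (q @ [l]))"
      using padded_snoc[of "length q" "map fst q" x] xb by simp
    moreover have "(padded (map (\<lambda>l. of_bool (snd l)) q))(length q := of_bool b) =
        padded (map (\<lambda>l. of_bool (snd l)) (q @ [l]))"
      using padded_snoc[of "length q" "map (\<lambda>l. of_bool (snd l)) q" "of_bool b"] xb by simp
    moreover have "arr ?s' (B + 3 + of_bool c) y = of_bool ((y, c) \<in> set (q @ [l]))" for y c
      using mark[of c y] xb by (cases b; cases c) (auto simp: write_array_def add.commute)
    ultimately have "queue B (q @ [l]) ?s'"
      using \<open>distinct q\<close> False Q unfolding queue_def
      by (cases b) (auto simp: write_array_def add.commute)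
    then show ?thesis
      using False mark[of b x] l xb tail unfolding push_def
      by (simp add: add.commute write_array_def)
  qed
qed

text \<open>Each position of the block costs at most 15 steps, up to 8 of them in
  \<open>push\<close>; the extra step is the failing test. The suffix \<open>r\<close> records that
  the queue grows only at its end.\<close>

lemma wp_push_rest:
  assumes sc: "scanned (concat cs) (clause_ids 1 cs) s" and B: "9 \<le> B"
    and k: "reg s r_occ = k" "1 \<le> k" "k \<le> length (concat cs)"
    and c: "reg s r_clause = occ_clause cs k" "reg s r_ix = occ_clause cs k"
    and q: "queue B q s"
  shows "wp (push_rest B) (\<lambda>T' s'. T' \<le> T + 15 * card (block cs (occ_clause cs k)) + 1 \<and>
    (\<exists>r. queue B (q @ r) s' \<and>
      set (q @ r) = set q \<union> (\<lambda>i. neg (lit (concat cs) i)) ` (block cs (occ_clause cs k) - {k}))) T s"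
proof -
  let ?c = "occ_clause cs k" and ?m = "length (concat cs)"
  obtain n where n: "\<And>j. occ_clause cs j = ?c \<longleftrightarrow> ?c \<le> j \<and> j < ?c + n"
    using block_interval(2)[OF k(2,3)] by blast
  have c1: "1 \<le> ?c" by (rule block_interval(1)[OF k(2,3)])
  have range: "1 \<le> j \<and> j \<le> ?m" if "occ_clause cs j = ?c" for j
    using that c1 by (cases "j = 0") (auto simp: padded_def split: if_splits)
  have block: "block cs ?c = {?c..<?c + n}"
  proof (intro set_eqI iffI)
    fix j assume "j \<in> block cs ?c"
    then show "j \<in> {?c..<?c + n}" using n[of j] by (simp add: block_def)
  next
    fix j assume "j \<in> {?c..<?c + n}"
    then have "occ_clause cs j = ?c" using n[of j] by simp
    then show "j \<in> block cs ?c" using range[of j] by (simp add: block_def)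
  qed
  define I where "I T' s' \<longleftrightarrow> (\<exists>j r. reg s' r_ix = j \<and> ?c \<le> j \<and> j \<le> ?c + n \<and>
    T' + 15 * (?c + n - j) \<le> T + 15 * n \<and> queue B (q @ r) s' \<and>
    set (q @ r) = set q \<union> (\<lambda>i. neg (lit (concat cs) i)) ` ({?c..<j} - {k}))" for T' s'
  let ?push = "Assign r_var (Read a_var (Reg r_ix)) ;; Assign r_sgn (Read a_sgn (Reg r_ix)) ;;
    negate r_sgn ;; push B"
  let ?body = "Cond (Equal (Reg r_ix) (Reg r_occ)) Skip ?push ;; Assign r_ix (Succ (Reg r_ix))"
  let ?b = "Equal (Read a_clause (Reg r_ix)) (Reg r_clause)"
  show ?thesis
    unfolding push_rest_def
  proof (rule wp_Loop[where I = I and B = "T + 15 * n"])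
    show "I T s" unfolding I_def using c q by (intro exI[of _ ?c] exI[of _ "[]"]) simp
  next
    fix T' s' assume "I T' s'" then show "T' \<le> T + 15 * n" by (auto simp: I_def)
  next
    fix T' s'
    assume I: "I T' s'" and fr: "framed (Loop ?b ?body) s s'" and b: "eval_test ?b s'"
    from I obtain j r where j: "reg s' r_ix = j" "?c \<le> j" "j \<le> ?c + n"
      and T': "T' + 15 * (?c + n - j) \<le> T + 15 * n" and r: "queue B (q @ r) s'"
      "set (q @ r) = set q \<union> (\<lambda>i. neg (lit (concat cs) i)) ` ({?c..<j} - {k})"
      unfolding I_def by blast
    have sc': "scanned (concat cs) (clause_ids 1 cs) s'"
      using scanned_framed[OF fr _ _ sc] B by auto
    have rc: "reg s' r_clause = ?c" "reg s' r_occ = k"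
      using fr k c by (simp_all add: framed_def)
    have "occ_clause cs j = ?c"
      using b sc' j rc by (simp add: scanned_def)
    then have "j < ?c + n" and j': "1 \<le> j" "j \<le> ?m" using n[of j] range[of j] by simp_all
    then have T'': "T' + 15 + 15 * (?c + n - Suc j) \<le> T + 15 * n" using T' by linarith
    have less: "{?c..<Suc j} = insert j {?c..<j}" using j by auto
    have step: "I T'' (s''\<lparr>reg := (reg s'')(r_ix := Suc j)\<rparr>)"
      if "T'' \<le> T' + 15" "queue B (q @ r') s''"
        "set (q @ r') = set q \<union> (\<lambda>i. neg (lit (concat cs) i)) ` ({?c..<Suc j} - {k})" for T'' s'' r'
    proof -
      have "queue B (q @ r') (s''\<lparr>reg := (reg s'')(r_ix := Suc j)\<rparr>)"
        using that(2) by (rule queue_cong[rotated 2]) simp_all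
      then show ?thesis
        unfolding I_def using that T'' \<open>j < ?c + n\<close> j(2)
        by (intro exI[of _ "Suc j"] exI[of _ r']) simp
    qed
    show "wp ?body I (T' + 1) s'"
    proof (cases "j = k")
      \<comment> \<open>The position being visited is skipped, as no edge joins a literal to its own
        negation.\<close>
      case True
      then have "{?c..<Suc j} - {k} = {?c..<j} - {k}" using less by auto
      then show ?thesis
        using True j(1) rc step[of "T' + 1 + 1 + 1 + 1" r s'] r by simp
    next
      case False
      let ?l = "neg (lit (concat cs) j)"
      let ?s = "s'\<lparr>reg := (reg s')(r_var := fst ?l, r_sgn := of_bool (snd ?l))\<rparr>"
      have a: "arr s' a_var j = fst ?l" "arr s' a_sgn j = of_bool (\<not> snd ?l)"
        using sc' j' by (simp_all add: scanned_def padded_def lit_def nth_Cons' )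
      have "queue B (q @ r) ?s"
        using r(1) by (rule queue_cong[rotated 2]) simp_all
      then have "wp (push B) (\<lambda>T'' s''. T'' \<le> (T' + 1 + 1 + 1 + 1 + 2) + 8 \<and>
          queue B (if ?l \<in> set (q @ r) then q @ r else (q @ r) @ [?l]) s'') (T' + 1 + 1 + 1 + 1 + 2) ?s"
        by (rule wp_push) simp_all
      then have "wp (push B) (wp (Assign r_ix (Succ (Reg r_ix))) I) (T' + 1 + 1 + 1 + 1 + 2) ?s"
      proof (rule wp_mono, elim conjE)
        fix T'' s''
        assume T'': "T'' \<le> (T' + 1 + 1 + 1 + 1 + 2) + 8" and fr: "framed (push B) ?s s''"
          and q': "queue B (if ?l \<in> set (q @ r) then q @ r else (q @ r) @ [?l]) s''"
        have ix: "reg s'' r_ix = j" using fr j(1) by (simp add: framed_def)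
        define r' where "r' = (if ?l \<in> set (q @ r) then r else r @ [?l])"
        have "queue B (q @ r') s''" using q' unfolding r'_def by (auto split: if_splits)
        moreover have "set (q @ r') = insert ?l (set (q @ r))" unfolding r'_def by auto
        moreover have "insert ?l (set (q @ r)) = set q \<union> (\<lambda>i. neg (lit (concat cs) i)) ` ({?c..<Suc j} - {k})"
          using False unfolding r(2) less by auto
        ultimately show "wp (Assign r_ix (Succ (Reg r_ix))) I T'' s''"
          using step[of "T'' + 1" r' s''] T'' by (simp add: ix)
      qed
      then show ?thesis using False j(1) rc a by (simp add: fun_upd_twist)
    qed
  next
    fix T' s'
    assume I: "I T' s'" and fr: "framed (Loop ?b ?body) s s'" and b: "\<not> eval_test ?b s'"
    from I obtain j r where j: "reg s' r_ix = j" "?c \<le> j" "j \<le> ?c + n"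
      and T': "T' + 15 * (?c + n - j) \<le> T + 15 * n" and r: "queue B (q @ r) s'"
      "set (q @ r) = set q \<union> (\<lambda>i. neg (lit (concat cs) i)) ` ({?c..<j} - {k})"
      unfolding I_def by blast
    have sc': "scanned (concat cs) (clause_ids 1 cs) s'"
      using scanned_framed[OF fr _ _ sc] B by auto
    have rc: "reg s' r_clause = ?c"
      using fr k c by (simp_all add: framed_def)
    have "occ_clause cs j \<noteq> ?c"
      using b sc' j rc by (simp add: scanned_def)
    then have "j = ?c + n" using n[of j] j(2,3) by linarith
    then show "T' + 1 \<le> T + 15 * card (block cs ?c) + 1 \<and> (\<exists>r. queue B (q @ r) s' \<and>
      set (q @ r) = set q \<union> (\<lambda>i. neg (lit (concat cs) i)) ` (block cs ?c - {k}))"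
      using T' r unfolding block by auto
  qed
qed

text \<open>A clause contributes its number of traversals times its length, so this is the total
  number of positions swept. It serves as the potential of the amortised analysis: two traversals
  per clause keep it within twice the number of occurrences.\<close>

definition traversals :: "clause list \<Rightarrow> nat \<Rightarrow> state \<Rightarrow> nat" where
  "traversals cs B s = (\<Sum>j\<in>{1..length (concat cs)}. arr s (B + 2) (occ_clause cs j))"

text \<open>\<open>Vis\<close> collects the occurrences visited so far. The traversal count of a
  clause is bounded by, not equal to, the visited occurrences in its block, because later visits
  skip the sweep; a count of 2 still certifies two different visited positions.\<close>

definition searching ::
    "clause list \<Rightarrow> nat \<Rightarrow> literal \<Rightarrow> nat set \<Rightarrow> literal list \<Rightarrow> state \<Rightarrow> bool" where
  "searching cs B l\<^sub>0 Vis q s \<longleftrightarrow>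
     scanned (concat cs) (clause_ids 1 cs) s \<and> queue B q s \<and>
     l\<^sub>0 \<in> set q \<and> set q \<subseteq> Collect (reach cs l\<^sub>0) \<and> Vis \<subseteq> {1..length (concat cs)} \<and>
     (\<forall>j \<in> Vis. \<forall>i \<in> block cs (occ_clause cs j). i \<noteq> j \<longrightarrow> neg (lit (concat cs) i) \<in> set q) \<and>
     (\<forall>c. arr s (B + 2) c \<le> 2 \<and> arr s (B + 2) c \<le> card (Vis \<inter> block cs c))"

lemma searching_cong:
  assumes "reg s' r_tail = reg s r_tail" "reg s' r_occs = reg s r_occs" "arr s' = arr s"
    and "searching cs B l\<^sub>0 Vis q s"
  shows "searching cs B l\<^sub>0 Vis q s'"
  using assms by (auto simp: searching_def scanned_def queue_def)

lemma traversals_le: "searching cs B l\<^sub>0 Vis q s \<Longrightarrow> traversals cs B s \<le> 2 * length (concat cs)"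
  unfolding traversals_def searching_def
  using sum_bounded_above[of "{1..length (concat cs)}" "\<lambda>j. arr s (B + 2) (occ_clause cs j)" 2] by simp

lemma block_Int: "block cs c = {1..length (concat cs)} \<inter> {j. occ_clause cs j = c}"
  by (auto simp: block_def)

text \<open>A visit costs 6 steps plus 15 for every position swept, and the rise of
  \<open>traversals\<close> pays for the sweep.\<close>

lemma wp_visit:
  assumes B: "9 \<le> B" and cs: "\<forall>C \<in> set cs. distinct C"
    and S: "searching cs B l\<^sub>0 Vis q s"
    and k: "reg s r_occ = k" "1 \<le> k" "k \<le> length (concat cs)"
    and new: "k \<notin> Vis" "lit (concat cs) k \<in> set q"
  shows "wp (visit B) (\<lambda>T' s'. T' + 15 * traversals cs B s \<le> T + 6 + 15 * traversals cs B s' \<and>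
    reg s' r_occ = arr s a_prev k \<and> (\<exists>r. searching cs B l\<^sub>0 (insert k Vis) (q @ r) s')) T s"
proof -
  let ?xs = "concat cs" and ?c = "occ_clause cs k"
  let ?n = "arr s (B + 2) ?c"
  have sc: "scanned ?xs (clause_ids 1 cs) s" and Q: "queue B q s" and l0: "l\<^sub>0 \<in> set q"
    and sound: "set q \<subseteq> Collect (reach cs l\<^sub>0)" and Vis: "Vis \<subseteq> {1..length ?xs}"
    and pushed: "\<forall>j \<in> Vis. \<forall>i \<in> block cs (occ_clause cs j). i \<noteq> j \<longrightarrow> neg (lit ?xs i) \<in> set q"
    and cnt: "\<And>c. arr s (B + 2) c \<le> 2" "\<And>c. arr s (B + 2) c \<le> card (Vis \<inter> block cs c)"
    using S by (simp_all add: searching_def)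
  have a: "arr s a_clause k = ?c" using sc by (simp add: scanned_def)
  have kb: "k \<in> block cs ?c" using k by (simp add: block_def)
  have fin: "finite Vis" using Vis by (rule finite_subset) simp
  have insert_cnt: "card (insert k Vis \<inter> block cs c) = card (Vis \<inter> block cs c) + of_bool (c = ?c)" for c
  proof (cases "c = ?c")
    case True
    then have "insert k Vis \<inter> block cs c = insert k (Vis \<inter> block cs c)" using kb by auto
    then show ?thesis using True new(1) fin by simp
  next
    case False
    then have "insert k Vis \<inter> block cs c = Vis \<inter> block cs c" by (auto simp: block_def)
    then show ?thesis using False by simp
  qed
  have reach_neg: "reach cs l\<^sub>0 (neg (lit ?xs i))" if "i \<in> block cs ?c" "i \<noteq> k" for i
  proof -
    have "edge cs (lit ?xs k) (neg (lit ?xs i))"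
      unfolding edge_iff_occ[OF cs]
      by (rule bexI[of _ k], rule bexI[of _ i]) (use that k in \<open>simp_all add: block_def\<close>)
    then show ?thesis using sound new(2) by (auto intro: rtranclp.rtrancl_into_rtrancl)
  qed
  let ?s1 = "s\<lparr>reg := (reg s)(r_clause := ?c)\<rparr>"
  show ?thesis
  proof (cases "?n < 2")
    case True
    let ?s2 = "s\<lparr>arr := (arr s)(B + 2 := (arr s (B + 2))(?c := Suc ?n)),
      reg := (reg s)(r_clause := ?c, r_ix := ?c)\<rparr>"
    have sc2: "scanned ?xs (clause_ids 1 cs) ?s2"
      using sc B by (simp add: scanned_def)
    have Q2: "queue B q ?s2"
      using Q by (rule queue_cong[rotated 2]) (auto)
    have "wp (push_rest B) (\<lambda>T' s'. T' \<le> (T + 1 + 1 + 1 + 1) + 15 * card (block cs ?c) + 1 \<and>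
      (\<exists>r. queue B (q @ r) s' \<and>
        set (q @ r) = set q \<union> (\<lambda>i. neg (lit ?xs i)) ` (block cs ?c - {k}))) (T + 1 + 1 + 1 + 1) ?s2"
      by (rule wp_push_rest[OF sc2 B _ k(2,3) _ _ Q2]) (simp_all add: k(1))
    then have "wp (push_rest B) (wp (Assign r_occ (Read a_prev (Reg r_occ)))
      (\<lambda>T' s'. T' + 15 * traversals cs B s \<le> T + 6 + 15 * traversals cs B s' \<and>
       reg s' r_occ = arr s a_prev k \<and> (\<exists>r. searching cs B l\<^sub>0 (insert k Vis) (q @ r) s')))
      (T + 1 + 1 + 1 + 1) ?s2"
    proof (rule wp_mono, elim conjE exE)
      fix T' s' r
      assume T': "T' \<le> (T + 1 + 1 + 1 + 1) + 15 * card (block cs ?c) + 1"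
        and Q': "queue B (q @ r) s'"
        and r: "set (q @ r) = set q \<union> (\<lambda>i. neg (lit ?xs i)) ` (block cs ?c - {k})"
        and fr: "framed (push_rest B) ?s2 s'"
      let ?s' = "s'\<lparr>reg := (reg s')(r_occ := arr s a_prev k)\<rparr>"
      have sc': "scanned ?xs (clause_ids 1 cs) s'"
        using scanned_framed[OF fr _ _ sc2] B by auto
      have cnt': "arr s' (B + 2) = (arr s (B + 2))(?c := Suc ?n)"
        using framed_arr[OF fr, of "B + 2"] by simp
      have prev: "arr s' a_prev k = arr s a_prev k" "reg s' r_occ = k"
        using framed_arr[OF fr, of a_prev] framed_reg[OF fr, of r_occ] B k(1) by simp_all
      \<comment> \<open>One more traversal raises the term of every occurrence in the block by 1,
        hence the potential by the size of the block.\<close>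
      have "traversals cs B ?s' = (\<Sum>j\<in>{1..length ?xs}. arr s (B + 2) (occ_clause cs j) + of_bool (occ_clause cs j = ?c))"
        unfolding traversals_def by (intro sum.cong) (simp_all add: cnt'[simplified])
      also have "\<dots> = traversals cs B s + card (block cs ?c)"
        by (simp only: sum.distrib traversals_def block_Int finite_atLeastAtMost sum_of_bool_eq of_nat_id)
      finally have tr: "traversals cs B ?s' = traversals cs B s + card (block cs ?c)" .
      have "searching cs B l\<^sub>0 (insert k Vis) (q @ r) ?s'"
        unfolding searching_def
      proof (intro conjI ballI impI allI)
        show "scanned ?xs (clause_ids 1 cs) ?s'" using sc' by (simp add: scanned_def)
        show "queue B (q @ r) ?s'" using Q' by (rule queue_cong[rotated 2]) simp_all
        show "l\<^sub>0 \<in> set (q @ r)" using l0 by simp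
        show "set (q @ r) \<subseteq> Collect (reach cs l\<^sub>0)"
          unfolding r using sound reach_neg by auto
        show "insert k Vis \<subseteq> {1..length ?xs}" using Vis k by simp
      next
        fix j i assume "j \<in> insert k Vis" "i \<in> block cs (occ_clause cs j)" "i \<noteq> j"
        then show "neg (lit ?xs i) \<in> set (q @ r)"
          unfolding r using pushed by blast
      next
        fix c
        show "arr ?s' (B + 2) c \<le> 2" using cnt(1)[of c] True by (simp add: cnt'[simplified])
        show "arr ?s' (B + 2) c \<le> card (insert k Vis \<inter> block cs c)"
          unfolding insert_cnt using cnt(2)[of c] by (auto simp: cnt'[simplified])
      qed
      then show "wp (Assign r_occ (Read a_prev (Reg r_occ))) (\<lambda>T' s'.
          T' + 15 * traversals cs B s \<le> T + 6 + 15 * traversals cs B s' \<and>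
          reg s' r_occ = arr s a_prev k \<and> (\<exists>r. searching cs B l\<^sub>0 (insert k Vis) (q @ r) s')) T' s'"
        using T' tr by (auto simp: prev)
    qed
    then show ?thesis
      using True k(1) a unfolding visit_def
      by (simp add: write_array_def)
  next
    case False
    let ?s' = "s\<lparr>reg := (reg s)(r_clause := ?c, r_occ := arr s a_prev k)\<rparr>"
    \<comment> \<open>Each position of the block differs from at least one of two visited ones, so
      the negation of its literal is already in the queue and skipping the sweep loses
      nothing.\<close>
    have "2 \<le> card (Vis \<inter> block cs ?c)" using False cnt(2)[of ?c] by linarith
    then obtain j1 j2 where j: "j1 \<in> Vis \<inter> block cs ?c" "j2 \<in> Vis \<inter> block cs ?c" "j1 \<noteq> j2"
      using card_le_Suc0_iff_eq[of "Vis \<inter> block cs ?c"] fin by fastforce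
    have rest: "neg (lit ?xs i) \<in> set q" if "i \<in> block cs ?c" for i
    proof -
      have "occ_clause cs j1 = ?c" "occ_clause cs j2 = ?c" using j by (simp_all add: block_def)
      then show ?thesis
        using pushed j that by (metis IntD1)
    qed
    have cnt'': "arr s (B + 2) c \<le> card (insert k Vis \<inter> block cs c)" for c
      unfolding insert_cnt using cnt(2)[of c] by linarith
    have "searching cs B l\<^sub>0 (insert k Vis) q s"
      unfolding searching_def
      using sc Q l0 sound Vis pushed cnt(1) cnt'' k rest by auto
    then have "searching cs B l\<^sub>0 (insert k Vis) q ?s'"
      by (rule searching_cong[rotated 3]) simp_all
    then have "\<exists>r. searching cs B l\<^sub>0 (insert k Vis) (q @ r) ?s'"
      by (intro exI[of _ "[]"]) simp
    moreover have "traversals cs B ?s' = traversals cs B s" by (simp add: traversals_def)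
    ultimately show ?thesis
      using False k(1) a unfolding visit_def by auto
  qed
qed

definition processed :: "clause list \<Rightarrow> literal list \<Rightarrow> nat set" where
  "processed cs ls = {j \<in> {1..length (concat cs)}. lit (concat cs) j \<in> set ls}"

text \<open>Apart from sweeps, an occurrence is charged 7 steps: 6 for its visit and one for the
  loop test. The extra 1 is the final test.\<close>

lemma wp_visit_occurrences:
  assumes B: "9 \<le> B" and cs: "\<forall>C \<in> set cs. distinct C"
    and S: "searching cs B l\<^sub>0 (processed cs ls) (ls @ l # q) s"
    and k: "last_occ (concat cs) (length (concat cs)) l (reg s r_occ)"
  shows "wp (Loop (Less (Const 0) (Reg r_occ)) (visit B))
    (\<lambda>T' s'. (\<exists>r. searching cs B l\<^sub>0 (processed cs (ls @ [l])) (ls @ l # q @ r) s') \<and>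
      T' + 15 * traversals cs B s + 7 * card (processed cs ls) \<le>
        T + 1 + 15 * traversals cs B s' + 7 * card (processed cs (ls @ [l]))) T s"
proof -
  let ?xs = "concat cs" and ?m = "length (concat cs)"
  have new: "l \<notin> set ls"
    using S by (auto simp: searching_def queue_def)
  \<comment> \<open>Chains run backwards: with the pointer at \<open>k\<close>, the occurrences of
    \<open>l\<close> after \<open>k\<close> are done, and with the pointer at 0 all of them
    are.\<close>
  define U where "U k = processed cs ls \<union> {j \<in> {1..?m}. lit ?xs j = l \<and> k < j}" for k
  have fin: "finite (U k)" for k by (auto simp: U_def processed_def)
  have card_U: "card (U k) \<le> ?m" for k
  proof -
    have "U k \<subseteq> {1..?m}" by (auto simp: U_def processed_def)
    from card_mono[OF _ this] show ?thesis by simp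
  qed
  define I where "I T' s' \<longleftrightarrow> (\<exists>k r. reg s' r_occ = k \<and> k \<le> ?m \<and> (0 < k \<longrightarrow> lit ?xs k = l) \<and>
    searching cs B l\<^sub>0 (U k) (ls @ l # q @ r) s' \<and>
    T' + 15 * traversals cs B s + 7 * card (processed cs ls) \<le>
      T + 15 * traversals cs B s' + 7 * card (U k))" for T' s'
  show ?thesis
  proof (rule wp_Loop[where I = I and B = "T + 15 * (2 * ?m) + 7 * ?m"])
    have "U (reg s r_occ) = processed cs ls"
      using k by (auto simp: U_def last_occ_def)
    then show "I T s"
      unfolding I_def using S k by (intro exI[of _ "reg s r_occ"] exI[of _ "[]"]) (simp add: last_occ_def)
  next
    fix T' s' assume "I T' s'"
    then obtain k r where "searching cs B l\<^sub>0 (U k) (ls @ l # q @ r) s'"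
      "T' + 15 * traversals cs B s + 7 * card (processed cs ls) \<le>
        T + 15 * traversals cs B s' + 7 * card (U k)"
      unfolding I_def by blast
    with traversals_le[OF this(1)] card_U[of k] show "T' \<le> T + 15 * (2 * ?m) + 7 * ?m"
      by linarith
  next
    fix T' s' assume "I T' s'" "eval_test (Less (Const 0) (Reg r_occ)) s'"
    then obtain k r where k: "reg s' r_occ = k" "1 \<le> k" "k \<le> ?m" "lit ?xs k = l"
      and S': "searching cs B l\<^sub>0 (U k) (ls @ l # q @ r) s'"
      and T': "T' + 15 * traversals cs B s + 7 * card (processed cs ls) \<le>
        T + 15 * traversals cs B s' + 7 * card (U k)"
      unfolding I_def by auto
    have "k \<notin> U k" using k(4) new by (simp add: U_def processed_def)
    have prev: "last_occ ?xs (k - 1) l (arr s' a_prev k)"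
      using S' k unfolding searching_def scanned_def by blast
    \<comment> \<open>No occurrence of \<open>l\<close> lies strictly between the predecessor in the
      chain and \<open>k\<close>.\<close>
    have U: "insert k (U k) = U (arr s' a_prev k)"
    proof (intro set_eqI iffI)
      fix j assume "j \<in> insert k (U k)"
      then show "j \<in> U (arr s' a_prev k)"
        using k prev by (auto simp: U_def last_occ_def)
    next
      fix j assume j: "j \<in> U (arr s' a_prev k)"
      show "j \<in> insert k (U k)"
      proof (cases "j < k \<and> lit ?xs j = l")
        case True
        then have "j \<le> arr s' a_prev k" 
          using prev k(2) unfolding last_occ_def by (metis Suc_diff_1 Suc_leI less_Suc_eq_le less_le_trans not_le zero_less_one)
        then show ?thesis using j by (auto simp: U_def)
      next
        case False
        then show ?thesis using j by (auto simp: U_def)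
      qed
    qed
    have card: "card (U (arr s' a_prev k)) = Suc (card (U k))"
      unfolding U[symmetric] using fin \<open>k \<notin> U k\<close> by simp
    have "wp (visit B) (\<lambda>T'' s''. T'' + 15 * traversals cs B s' \<le> (T' + 1) + 6 + 15 * traversals cs B s'' \<and>
        reg s'' r_occ = arr s' a_prev k \<and>
        (\<exists>r'. searching cs B l\<^sub>0 (insert k (U k)) ((ls @ l # q @ r) @ r') s'')) (T' + 1) s'"
      by (rule wp_visit[OF B cs S' k(1-3) \<open>k \<notin> U k\<close>]) (simp add: k(4))
    then show "wp (visit B) I (T' + 1) s'"
    proof (rule wp_mono, elim conjE exE)
      fix T'' s'' r'
      assume "T'' + 15 * traversals cs B s' \<le> (T' + 1) + 6 + 15 * traversals cs B s''"
        and "reg s'' r_occ = arr s' a_prev k"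
        and "searching cs B l\<^sub>0 (insert k (U k)) ((ls @ l # q @ r) @ r') s''"
      then show "I T'' s''"
        unfolding I_def using prev T' k card
        by (intro exI[of _ "arr s' a_prev k"] exI[of _ "r @ r'"]) (auto simp: U last_occ_def)
    qed
  next
    fix T' s' assume "I T' s'" "\<not> eval_test (Less (Const 0) (Reg r_occ)) s'"
    moreover have "U 0 = processed cs (ls @ [l])" by (auto simp: U_def processed_def)
    ultimately show "(\<exists>r. searching cs B l\<^sub>0 (processed cs (ls @ [l])) (ls @ l # q @ r) s') \<and>
      T' + 1 + 15 * traversals cs B s + 7 * card (processed cs ls) \<le>
        T + 1 + 15 * traversals cs B s' + 7 * card (processed cs (ls @ [l]))"
      unfolding I_def by auto
  qed
qed

text \<open>Apart from the start, only negations of occurring literals can be reached. The bound is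
  free of \<open>nvars\<close>, as it must be, since \<open>nvars\<close> does not count towards the
  length of the formula.\<close>

lemma length_queue_le:
  assumes "searching cs B l\<^sub>0 Vis q s"
  shows "length q \<le> 1 + length (concat cs)"
proof -
  have "set q \<subseteq> insert l\<^sub>0 (neg ` set (concat cs))"
  proof
    fix l assume "l \<in> set q"
    then have "reach cs l\<^sub>0 l" using assms by (auto simp: searching_def)
    from reach_cases[OF this] show "l \<in> insert l\<^sub>0 (neg ` set (concat cs))"
      by (metis UN_I image_eqI insertCI neg_neg set_concat)
  qed
  then have "card (set q) \<le> card (insert l\<^sub>0 (neg ` set (concat cs)))"
    by (intro card_mono) simp_all
  also have "\<dots> \<le> Suc (card (neg ` set (concat cs)))" by (rule card_insert_le_m1) simp_all
  also have "card (neg ` set (concat cs)) \<le> length (concat cs)"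
    using card_image_le[of "set (concat cs)" neg] card_length[of "concat cs"] by simp
  finally show ?thesis using assms by (simp add: searching_def queue_def distinct_card)
qed

lemma wp_search:
  assumes B: "9 \<le> B" and cs: "\<forall>C \<in> set cs. distinct C"
    and sc: "scanned (concat cs) (clause_ids 1 cs) s"
    and z: "\<And>a. B \<le> a \<Longrightarrow> a \<le> B + 4 \<Longrightarrow> arr s a = (\<lambda>_. 0)"
    and l0: "reg s r_var = fst l\<^sub>0" "reg s r_sgn = of_bool (snd l\<^sub>0)"
  shows "wp (search B) (\<lambda>T' s'. T' \<le> T + 50 * length (concat cs) + 20 \<and>
    scanned (concat cs) (clause_ids 1 cs) s' \<and>
    (\<exists>q. queue B q s' \<and> set q = Collect (reach cs l\<^sub>0) \<and> length q \<le> 1 + length (concat cs))) T s"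
proof -
  let ?xs = "concat cs" and ?m = "length (concat cs)"
  let ?b = "Less (Reg r_head) (Reg r_tail)"
  let ?body = "read_signed r_occ a_last (Read (B + 1) (Reg r_head)) (Read B (Reg r_head)) ;;
        Loop (Less (Const 0) (Reg r_occ)) (visit B) ;;
        Assign r_head (Succ (Reg r_head))"
  let ?Q = "\<lambda>T' s'. T' \<le> T + 50 * ?m + 20 \<and>
    scanned ?xs (clause_ids 1 cs) s' \<and>
    (\<exists>q. queue B q s' \<and> set q = Collect (reach cs l\<^sub>0) \<and> length q \<le> 1 + ?m)"
  \<comment> \<open>Per processed literal 5 steps: the outer test, two for reading the chain head,
    the failing inner test, and advancing \<open>r_head\<close>. Occurrences cost 7 and swept
    positions 15 as before. The 10 in the invariant is the cost up to the loop.\<close>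
  let ?\<Phi> = "\<lambda>h ls s. 5 * h + 7 * card (processed cs ls) + 15 * traversals cs B s"
  define I where "I T' s' \<longleftrightarrow> (\<exists>ls q. reg s' r_head = length ls \<and>
    searching cs B l\<^sub>0 (processed cs ls) (ls @ q) s' \<and> T' \<le> T + 10 + ?\<Phi> (length ls) ls s')" for T' s'
  have potential: "?\<Phi> (length ls) ls s' \<le> 5 * (1 + ?m) + 7 * ?m + 15 * (2 * ?m)"
    if "searching cs B l\<^sub>0 (processed cs ls) (ls @ q) s'" for ls q s'
  proof -
    have "card (processed cs ls) \<le> ?m"
    proof -
      have "processed cs ls \<subseteq> {1..?m}" by (auto simp: processed_def)
      from card_mono[OF _ this] show ?thesis by simp
    qed
    then show ?thesis using traversals_le[OF that] length_queue_le[OF that] by simp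
  qed
  have loop: "wp (Loop ?b ?body) ?Q T1 s1" if "I T1 s1" for T1 s1
    using that
  proof (rule wp_Loop[where B = "T + 10 + (5 * (1 + ?m) + 7 * ?m + 15 * (2 * ?m))"])
    fix T' s' assume "I T' s'"
    then show "T' \<le> T + 10 + (5 * (1 + ?m) + 7 * ?m + 15 * (2 * ?m))"
      unfolding I_def using potential by (meson add_left_mono order_trans)
  next
    fix T' s' assume I: "I T' s'" and b: "eval_test ?b s'"
    then obtain ls q where h: "reg s' r_head = length ls"
      and S: "searching cs B l\<^sub>0 (processed cs ls) (ls @ q) s'"
      and T': "T' \<le> T + 10 + ?\<Phi> (length ls) ls s'"
      unfolding I_def by blast
    have "reg s' r_tail = length (ls @ q)" using S by (simp add: searching_def queue_def)
    then obtain l q' where q: "q = l # q'" using b h by (cases q) auto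
    have l: "arr s' B (length ls) = fst l" "arr s' (B + 1) (length ls) = of_bool (snd l)"
      using S by (simp_all add: searching_def queue_def q padded_def nth_append)
    let ?k = "arr s' (a_last + of_bool (snd l)) (fst l)"
    let ?s = "s'\<lparr>reg := (reg s')(r_occ := ?k)\<rparr>"
    have "last_occ ?xs ?m (fst l, snd l) ?k"
      using S by (simp only: searching_def scanned_def)
    then have k: "last_occ ?xs ?m l (reg ?s r_occ)" by simp
    have "searching cs B l\<^sub>0 (processed cs ls) (ls @ l # q') ?s"
      using S unfolding q by (rule searching_cong[rotated 3]) simp_all
    from wp_visit_occurrences[OF B cs this k, of "T' + 1 + 2"]
    have "wp (Loop (Less (Const 0) (Reg r_occ)) (visit B)) (wp (Assign r_head (Succ (Reg r_head))) I) (T' + 1 + 2) ?s"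
    proof (rule wp_mono, elim conjE exE)
      fix T'' s'' r
      assume S'': "searching cs B l\<^sub>0 (processed cs (ls @ [l])) (ls @ l # q' @ r) s''"
        and T'': "T'' + 15 * traversals cs B ?s + 7 * card (processed cs ls) \<le>
          T' + 1 + 2 + 1 + 15 * traversals cs B s'' + 7 * card (processed cs (ls @ [l]))"
        and fr: "framed (Loop (Less (Const 0) (Reg r_occ)) (visit B)) ?s s''"
      have h'': "reg s'' r_head = length ls" using fr h by (simp add: framed_def)
      let ?s' = "s''\<lparr>reg := (reg s'')(r_head := Suc (length ls))\<rparr>"
      have "searching cs B l\<^sub>0 (processed cs (ls @ [l])) ((ls @ [l]) @ q' @ r) ?s'"
        using S'' by (intro searching_cong[of ?s' s'']) simp_all
      moreover have "T'' + 1 \<le> T + 10 + ?\<Phi> (length (ls @ [l])) (ls @ [l]) ?s'"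
        using T'' T' by (simp add: traversals_def)
      ultimately have "I (T'' + 1) ?s'"
        unfolding I_def by (intro exI[of _ "ls @ [l]"] exI[of _ "q' @ r"]) simp
      then show "wp (Assign r_head (Succ (Reg r_head))) I T'' s''" by (simp add: h'')
    qed
    then show "wp ?body I (T' + 1) s'" using h l by simp
  next
    fix T' s' assume I: "I T' s'" and b: "\<not> eval_test ?b s'"
    then obtain ls q where h: "reg s' r_head = length ls"
      and S: "searching cs B l\<^sub>0 (processed cs ls) (ls @ q) s'"
      and T': "T' \<le> T + 10 + ?\<Phi> (length ls) ls s'"
      unfolding I_def by blast
    have "reg s' r_tail = length (ls @ q)" using S by (simp add: searching_def queue_def)
    then have q: "q = []" using b h by simp
    \<comment> \<open>With the queue exhausted, every occurrence of a queued literal has been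
      visited, so the queue is closed under edges; since it holds only reachable literals, it is
      exactly the reachable set.\<close>
    have "closed_under cs (set ls)"
      unfolding closed_under_def
    proof (intro ballI allI impI)
      fix l l' assume "l \<in> set ls" "edge cs l l'"
      then obtain i j where ij: "i \<in> {1..?m}" "j \<in> {1..?m}" "occ_clause cs i = occ_clause cs j"
        "i \<noteq> j" "lit ?xs i = l" "lit ?xs j = neg l'"
        unfolding edge_iff_occ[OF cs] by blast
      then have "i \<in> processed cs ls" "j \<in> block cs (occ_clause cs i)"
        using \<open>l \<in> set ls\<close> by (simp_all add: processed_def block_def)
      then have "neg (lit ?xs j) \<in> set ls"
        using S ij(4) unfolding searching_def q by (metis append_Nil2)
      then show "l' \<in> set ls" using ij(6) by simp
    qed
    moreover have "l\<^sub>0 \<in> set ls" using S by (simp add: searching_def q)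
    ultimately have "Collect (reach cs l\<^sub>0) \<subseteq> set ls"
      using closed_reach by blast
    moreover have "set ls \<subseteq> Collect (reach cs l\<^sub>0)" using S by (simp add: searching_def q)
    ultimately have "set ls = Collect (reach cs l\<^sub>0)" by (rule antisym[rotated])
    moreover have "T' \<le> T + 10 + (5 * (1 + ?m) + 7 * ?m + 15 * (2 * ?m))"
      using T' potential[OF S] by (meson add_left_mono order_trans)
    then have "T' + 1 \<le> T + 50 * ?m + 20" by simp
    ultimately show "?Q (T' + 1) s'"
      using S length_queue_le[OF S] by (auto simp: searching_def q)
  qed
  let ?s0 = "s\<lparr>reg := (reg s)(r_tail := 0)\<rparr>"
  have "arr s (B + 3 + of_bool b) = (\<lambda>_. 0)" for b using z[of "B + 3 + of_bool b"] by (cases b) simp_all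
  then have "queue B [] ?s0"
    using z by (simp add: queue_def padded_nil)
  then have "wp (push B) (\<lambda>T' s'. T' \<le> (T + 1) + 8 \<and>
      queue B (if l\<^sub>0 \<in> set [] then [] else [] @ [l\<^sub>0]) s') (T + 1) ?s0"
    by (rule wp_push) (simp_all add: l0)
  then have "wp (push B) (wp (Assign r_head (Const 0) ;; Loop ?b ?body) ?Q) (T + 1) ?s0"
  proof (rule wp_mono, elim conjE)
    fix T' s'
    assume T': "T' \<le> (T + 1) + 8" and fr: "framed (push B) ?s0 s'"
      and Q: "queue B (if l\<^sub>0 \<in> set [] then [] else [] @ [l\<^sub>0]) s'"
    let ?s' = "s'\<lparr>reg := (reg s')(r_head := 0)\<rparr>"
    have "scanned ?xs (clause_ids 1 cs) ?s0" using sc by (simp add: scanned_def)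
    then have "scanned ?xs (clause_ids 1 cs) s'" using scanned_framed[OF fr] B by auto
    moreover have "arr s' (B + 2) = (\<lambda>_. 0)" using framed_arr[OF fr, of "B + 2"] z[of "B + 2"] by simp
    ultimately have "searching cs B l\<^sub>0 (processed cs []) [l\<^sub>0] s'"
      using Q by (simp add: searching_def processed_def)
    then have "searching cs B l\<^sub>0 (processed cs []) ([] @ [l\<^sub>0]) ?s'"
      using searching_cong[of ?s' s'] by simp
    then have "I (T' + 1) ?s'"
      unfolding I_def using T' by (intro exI[of _ "[]"] exI[of _ "[l\<^sub>0]"]) simp
    then show "wp (Assign r_head (Const 0) ;; Loop ?b ?body) ?Q T' s'"
      using loop[of "T' + 1" ?s'] by simp
  qed
  then show ?thesis unfolding search_def by simp
qed

section \<open>The algorithm\<close>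

abbreviation (input) "r_start_var \<equiv> 16 :: nat"
abbreviation (input) "r_start_sgn \<equiv> 17 :: nat"

text \<open>Any literal whose negation is unmarked will do, so later finds may overwrite earlier
  ones. The preset start, the negation of the first variable, survives if there is none.\<close>

definition pick_start :: "nat \<Rightarrow> program" where
  "pick_start B =
     Assign r_start_var (Const 1) ;;
     Assign r_start_sgn (Const 0) ;;
     Assign r_ix (Const 0) ;;
     Loop (Less (Reg r_ix) (Reg r_tail))
       (Assign r_var (Read B (Reg r_ix)) ;;
        Assign r_sgn (Read (B + 1) (Reg r_ix)) ;;
        negate r_sgn ;;
        read_signed r_val (B + 3) (Reg r_sgn) (Reg r_var) ;;
        Cond (Equal (Reg r_val) (Const 0))
          (negate r_sgn ;;
           Assign r_start_var (Reg r_var) ;;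
           Assign r_start_sgn (Reg r_sgn))
          Skip ;;
        Assign r_ix (Succ (Reg r_ix)))"

text \<open>
  The emitted list serves as the renaming, and for a set closed under negation also as one side
  of the separation.
\<close>

definition emit_negative :: "nat \<Rightarrow> program" where
  "emit_negative B =
     Assign 1 (Const 0) ;;
     Assign r_ix (Const 0) ;;
     Loop (Less (Reg r_ix) (Reg r_tail))
       (Cond (Equal (Read (B + 1) (Reg r_ix)) (Const 0))
          (Write 1 (Reg 1) (Read B (Reg r_ix)) ;; Assign 1 (Succ (Reg 1)))
          Skip ;;
        Assign r_ix (Succ (Reg r_ix)))"

text \<open>If the negation of the start is marked, \<open>second_search\<close> shows the reached
  set to be closed under negation, so the marks of negative literals stand for variables. The loop
  passes only variables in the queue, so its cost depends on the queue and not on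
  \<open>nvars\<close>; ending beyond \<open>nvars\<close> means that every variable was
  reached.\<close>

definition conclude :: "nat \<Rightarrow> program" where
  "conclude B =
     negate r_start_sgn ;;
     read_signed r_val (B + 3) (Reg r_start_sgn) (Reg r_start_var) ;;
     Cond (Equal (Reg r_val) (Const 0))
       (Assign 0 (Const 3))
       (Assign r_ix (Const 1) ;;
        Loop (Neg (Equal (Read (B + 3) (Reg r_ix)) (Const 0))) (Assign r_ix (Succ (Reg r_ix))) ;;
        Cond (Less (Read 0 (Const 0)) (Reg r_ix))
          (Assign 0 (Const 0))
          (Write 2 (Const 0) (Reg r_ix) ;; Assign 2 (Const 1) ;; Assign 0 (Const 2)))"

text \<open>The two searches own disjoint banks of arrays, so the second one starts from zero marks
  without any clearing. Exclusive ORs are answered before the clauses are read.\<close>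

definition algorithm :: program where
  "algorithm =
     Cond (Equal (Read 0 (Const 1)) (Const 1))
       (Assign 0 (Const 1))
       (scan ;;
        Assign r_var (Const 1) ;;
        Assign r_sgn (Const 1) ;;
        search 10 ;;
        pick_start 10 ;;
        Assign r_var (Reg r_start_var) ;;
        Assign r_sgn (Reg r_start_sgn) ;;
        search 20 ;;
        emit_negative 20 ;;
        conclude 20)"

lemma written_scan [simp]:
  "written_arrays scan = {3, 4, 5, 6, 7, 8}"
  by (auto simp: scan_def scan_clause_def append_occ_def)

lemma written_algorithm [simp]:
  "written_regs (pick_start B) = {r_val, r_ix, r_var, r_sgn, r_start_var, r_start_sgn}"
  "written_arrays (pick_start B) = {}"
  "written_regs (emit_negative B) = {1, r_ix}"
  "written_arrays (emit_negative B) = {1}"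
  "written_regs (conclude B) = {0, 2, r_val, r_ix, r_start_sgn}"
  "written_arrays (conclude B) = {2}"
  by (auto simp: pick_start_def emit_negative_def conclude_def)

section \<open>Correctness of the phases around the searches\<close>

lemma queue_framed:
  assumes "framed p s s'" "r_tail \<notin> written_regs p"
    and "written_arrays p \<inter> {B, B + 1, B + 3, B + 4} = {}" "queue B q s"
  shows "queue B q s'"
proof (rule queue_cong[OF _ _ assms(4)])
  show "arr s' a = arr s a" if "a \<in> {B, B + 1, B + 3, B + 4}" for a
    using framed_arr[OF assms(1)] assms(3) that by blast
qed (rule framed_reg[OF assms(1,2)])

lemma wp_pick_start:
  assumes q: "queue B q s"
  shows "wp (pick_start B) (\<lambda>T' s'. T' \<le> T + 13 * length q + 4 \<and>
    (\<exists>l. reg s' r_start_var = fst l \<and> reg s' r_start_sgn = of_bool (snd l) \<and>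
      (l \<in> set q \<and> neg l \<notin> set q \<or> l = (1, False) \<and> self_dual (set q)))) T s"
proof -
  \<comment> \<open>Either a literal lacking its negation has been recorded, or all entries
    inspected so far have their negations in the queue; after the last entry the second case is
    self-duality.\<close>
  define G where "G j s' \<longleftrightarrow> (\<exists>l. reg s' r_start_var = fst l \<and> reg s' r_start_sgn = of_bool (snd l) \<and>
      (l \<in> set q \<and> neg l \<notin> set q \<or> l = (1, False) \<and> (\<forall>l \<in> set (take j q). neg l \<in> set q)))" for j and s' :: state
  define I where "I T' s' \<longleftrightarrow> reg s' r_ix \<le> length q \<and> G (reg s' r_ix) s' \<and>
    T' \<le> T + 3 + 13 * reg s' r_ix" for T' and s' :: state
  let ?s = "s\<lparr>reg := (reg s)(r_start_var := 1, r_start_sgn := 0, r_ix := 0)\<rparr>"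
  let ?b = "Less (Reg r_ix) (Reg r_tail)"
  let ?body = "Assign r_var (Read B (Reg r_ix)) ;;
        Assign r_sgn (Read (B + 1) (Reg r_ix)) ;;
        negate r_sgn ;;
        read_signed r_val (B + 3) (Reg r_sgn) (Reg r_var) ;;
        Cond (Equal (Reg r_val) (Const 0))
          (negate r_sgn ;;
           Assign r_start_var (Reg r_var) ;;
           Assign r_start_sgn (Reg r_sgn))
          Skip ;;
        Assign r_ix (Succ (Reg r_ix))"
  have "queue B q ?s" using q by (rule queue_cong[rotated 2]) simp_all
  then have q': "queue B q s'" if "framed (Loop ?b ?body) ?s s'" for s'
    by (rule queue_framed[OF that, rotated 2]) simp_all
  have "wp (Loop ?b ?body) (\<lambda>T' s'. T' \<le> T + 13 * length q + 4 \<and>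
    (\<exists>l. reg s' r_start_var = fst l \<and> reg s' r_start_sgn = of_bool (snd l) \<and>
      (l \<in> set q \<and> neg l \<notin> set q \<or> l = (1, False) \<and> self_dual (set q)))) (T + 1 + 1 + 1) ?s"
  proof (rule wp_Loop[where I = I and B = "T + 3 + 13 * length q"])
    show "I (T + 1 + 1 + 1) ?s"
      unfolding I_def G_def by (intro conjI exI[of _ "(1, False)"]) simp_all
  next
    fix T' s' assume "I T' s'"
    then show "T' \<le> T + 3 + 13 * length q" by (simp add: I_def)
  next
    fix T' s' assume I: "I T' s'" and fr: "framed (Loop ?b ?body) ?s s'" and b: "eval_test ?b s'"
    let ?j = "reg s' r_ix"
    have Q: "queue B q s'" by (rule q'[OF fr])
    then have j: "?j < length q" using b by (simp add: queue_def)
    obtain x c where xc: "q ! ?j = (x, c)" by (cases "q ! ?j")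
    have rd: "arr s' B ?j = x" "arr s' (B + 1) ?j = of_bool c"
      and mark: "arr s' (B + 3 + of_bool (\<not> c)) x = of_bool ((x, \<not> c) \<in> set q)"
      using Q j xc by (simp_all add: queue_def padded_def)
    have mem: "(x, c) \<in> set q" using j xc nth_mem by metis
    have step: "G (Suc ?j) s''"
      if "if (x, \<not> c) \<in> set q then reg s'' r_start_var = reg s' r_start_var \<and> reg s'' r_start_sgn = reg s' r_start_sgn
          else reg s'' r_start_var = x \<and> reg s'' r_start_sgn = of_bool c" for s''
    proof (cases "(x, \<not> c) \<in> set q")
      case True
      have "set (take (Suc ?j) q) = insert (x, c) (set (take ?j q))"
        using j xc by (simp add: take_Suc_conv_app_nth)
      then show ?thesis using I that True unfolding I_def G_def by auto
    next
      case False
      then show ?thesis using that mem unfolding G_def by (intro exI[of _ "(x, c)"]) simp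
    qed
    show "wp ?body I (T' + 1) s'"
      using I j rd mark unfolding I_def
      by (cases c) (auto simp: add.commute intro!: step split: if_splits)
  next
    fix T' s' assume I: "I T' s'" and fr: "framed (Loop ?b ?body) ?s s'" and b: "\<not> eval_test ?b s'"
    have "reg s' r_ix = length q" using q'[OF fr] b I by (simp add: queue_def I_def)
    then show "T' + 1 \<le> T + 13 * length q + 4 \<and>
      (\<exists>l. reg s' r_start_var = fst l \<and> reg s' r_start_sgn = of_bool (snd l) \<and>
        (l \<in> set q \<and> neg l \<notin> set q \<or> l = (1, False) \<and> self_dual (set q)))"
      using I by (simp add: I_def G_def self_dual_def)
  qed
  then show ?thesis unfolding pick_start_def by (simp only: wp_Seq wp_Assign eval_expr.simps) simp
qed

lemma wp_emit_negative:
  assumes q: "queue B q s" and B: "3 \<le> B"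
  shows "wp (emit_negative B) (\<lambda>T' s'. T' \<le> T + 5 * length q + 3 \<and>
    listed_set s' 1 = {x. (x, False) \<in> set q}) T s"
proof -
  define I where "I T' s' \<longleftrightarrow> reg s' r_ix \<le> length q \<and>
    listed_set s' 1 = {x. (x, False) \<in> set (take (reg s' r_ix) q)} \<and>
    T' \<le> T + 2 + 5 * reg s' r_ix" for T' and s' :: state
  let ?s = "s\<lparr>reg := (reg s)(1 := 0, r_ix := 0)\<rparr>"
  let ?b = "Less (Reg r_ix) (Reg r_tail)"
  let ?body = "Cond (Equal (Read (B + 1) (Reg r_ix)) (Const 0))
          (Write 1 (Reg 1) (Read B (Reg r_ix)) ;; Assign 1 (Succ (Reg 1)))
          Skip ;;
        Assign r_ix (Succ (Reg r_ix))"
  have "queue B q ?s" using q by (rule queue_cong[rotated 2]) simp_all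
  then have q': "queue B q s'" if "framed (Loop ?b ?body) ?s s'" for s'
    by (rule queue_framed[OF that, rotated 2]) (use B in auto)
  have "wp (Loop ?b ?body) (\<lambda>T' s'. T' \<le> T + 5 * length q + 3 \<and>
    listed_set s' 1 = {x. (x, False) \<in> set q}) (T + 1 + 1) ?s"
  proof (rule wp_Loop[where I = I and B = "T + 2 + 5 * length q"])
    show "I (T + 1 + 1) ?s" by (simp add: I_def listed_set_def)
  next
    fix T' s' assume "I T' s'"
    then show "T' \<le> T + 2 + 5 * length q" by (simp add: I_def)
  next
    fix T' s' assume I: "I T' s'" and fr: "framed (Loop ?b ?body) ?s s'" and b: "eval_test ?b s'"
    let ?j = "reg s' r_ix"
    have Q: "queue B q s'" by (rule q'[OF fr])
    then have j: "?j < length q" using b by (simp add: queue_def)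
    obtain x c where xc: "q ! ?j = (x, c)" by (cases "q ! ?j")
    have rd: "arr s' B ?j = x" "arr s' (B + 1) ?j = of_bool c"
      using Q j xc by (simp_all add: queue_def padded_def)
    have tk: "set (take (Suc ?j) q) = insert (x, c) (set (take ?j q))"
      using j xc by (simp add: take_Suc_conv_app_nth)
    have upd: "(f(k := y)) ` {..<Suc k} = insert y (f ` {..<k})" for f :: "nat \<Rightarrow> nat" and k y
      by (auto simp: lessThan_Suc)
    show "wp ?body I (T' + 1) s'"
    proof (cases c)
      case True
      then show ?thesis using I j rd tk by (simp add: I_def listed_set_def)
    next
      case False
      then show ?thesis
        using I j rd tk by (auto simp: I_def listed_set_def write_array_def upd[simplified])
    qed
  next
    fix T' s' assume I: "I T' s'" and fr: "framed (Loop ?b ?body) ?s s'" and b: "\<not> eval_test ?b s'"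
    have "reg s' r_ix = length q" using q'[OF fr] b I by (simp add: queue_def I_def)
    then show "T' + 1 \<le> T + 5 * length q + 3 \<and> listed_set s' 1 = {x. (x, False) \<in> set q}"
      using I by (simp add: I_def)
  qed
  then show ?thesis unfolding emit_negative_def by simp
qed

lemma wp_conclude:
  assumes q: "queue B q s" and B: "3 \<le> B"
    and l: "reg s r_start_var = fst l" "reg s r_start_sgn = of_bool (snd l)"
  shows "wp (conclude B) (\<lambda>T' s'. T' \<le> T + 2 * length q + 11 \<and>
    (if neg l \<notin> set q then reg s' 0 = 3
     else (\<exists>y \<ge> 1. (y, False) \<notin> set q \<and> (\<forall>x. 1 \<le> x \<and> x < y \<longrightarrow> (x, False) \<in> set q) \<and>
       (if arr s 0 0 < y then reg s' 0 = 0 else reg s' 0 = 2 \<and> listed_set s' 2 = {y})))) T s"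
proof -
  obtain x c where xc: "l = (x, c)" by (cases l)
  have mark: "arr s (B + 3 + of_bool b) y = of_bool ((y, b) \<in> set q)" for b y
    using q by (simp add: queue_def)
  have m0: "arr s (B + 3) y = of_bool ((y, False) \<in> set q)" for y using mark[of False y] by simp
  show ?thesis
  proof (cases "neg l \<in> set q")
    case False
    then show ?thesis
      using mark[of "\<not> c" x] l xc unfolding conclude_def by (cases c) (simp_all add: add.commute)
  next
    case True
    let ?s = "s\<lparr>reg := (reg s)(r_start_sgn := of_bool (\<not> c), r_val := 1, r_ix := 1)\<rparr>"
    let ?b = "Neg (Equal (Read (B + 3) (Reg r_ix)) (Const 0))"
    let ?body = "Assign r_ix (Succ (Reg r_ix))"
    let ?rest = "Cond (Less (Read 0 (Const 0)) (Reg r_ix))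
          (Assign 0 (Const 0))
          (Write 2 (Const 0) (Reg r_ix) ;; Assign 2 (Const 1) ;; Assign 0 (Const 2))"
    let ?Q = "\<lambda>T' s'. T' \<le> T + 2 * length q + 11 \<and>
       (\<exists>y \<ge> 1. (y, False) \<notin> set q \<and> (\<forall>x. 1 \<le> x \<and> x < y \<longrightarrow> (x, False) \<in> set q) \<and>
       (if arr s 0 0 < y then reg s' 0 = 0 else reg s' 0 = 2 \<and> listed_set s' 2 = {y}))"
    define I where "I T' s' \<longleftrightarrow> 1 \<le> reg s' r_ix \<and>
      (\<forall>x. 1 \<le> x \<and> x < reg s' r_ix \<longrightarrow> (x, False) \<in> set q) \<and>
      T' \<le> T + 4 + 2 * reg s' r_ix" for T' and s' :: state
    \<comment> \<open>The numbers passed are distinct variables of queue entries, so there are at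
      most \<open>length q\<close> of them.\<close>
    have bound: "T' \<le> T + 4 + 2 * Suc (length q)" if I: "I T' s'" for T' s'
    proof -
      have "{1..<reg s' r_ix} \<subseteq> fst ` set q" using I by (force simp: I_def)
      then have "card {1..<reg s' r_ix} \<le> card (fst ` set q)" by (intro card_mono) simp_all
      also have "\<dots> \<le> length q" by (meson card_image_le card_length finite_set order_trans)
      finally have "reg s' r_ix \<le> Suc (length q)" by simp
      then show ?thesis using I by (simp add: I_def)
    qed
    have "wp (Loop ?b ?body) (wp ?rest ?Q) (T + 6) ?s"
    proof (rule wp_Loop[where I = I and B = "T + 4 + 2 * Suc (length q)"])
      show "I (T + 6) ?s" by (simp add: I_def)
    next
      fix T' s' assume "I T' s'"
      then show "T' \<le> T + 4 + 2 * Suc (length q)" by (rule bound)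
    next
      fix T' s' assume I: "I T' s'" and fr: "framed (Loop ?b ?body) ?s s'" and b: "eval_test ?b s'"
      have "arr s' (B + 3) = arr s (B + 3)" using framed_arr[OF fr, of "B + 3"] by simp
      then have "(reg s' r_ix, False) \<in> set q" using b m0 by simp
      then show "wp ?body I (T' + 1) s'" using I by (auto simp: I_def less_Suc_eq)
    next
      fix T' s' assume I: "I T' s'" and fr: "framed (Loop ?b ?body) ?s s'" and b: "\<not> eval_test ?b s'"
      have a: "arr s' a = arr s a" for a using framed_arr[OF fr, of a] by simp
      then have "(reg s' r_ix, False) \<notin> set q" using b m0 by simp
      moreover have "T' \<le> T + 4 + 2 * Suc (length q)" using I by (rule bound)
      ultimately show "wp ?rest ?Q (T' + 1) s'"
        using I by (auto simp: I_def a listed_set_def write_array_def intro!: exI[of _ "reg s' r_ix"])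
    qed
    then show ?thesis
      using True mark[of "\<not> c" x] l xc unfolding conclude_def
      by (cases c) (simp_all add: add.commute numeral_eq_Suc)
  qed
qed

text \<open>\<open>R\<close> is closed under reachability, so a literal of \<open>R\<close> that
  reaches its negation cannot lack it in \<open>R\<close>. The start is then the negation of the
  first variable; by self-duality it lies in \<open>R\<close>, so the two literals of that variable
  reach each other and have the same reachable set.\<close>

lemma second_search:
  assumes start: "l \<in> R \<and> neg l \<notin> R \<or> l = (1, False) \<and> self_dual R"
    and R: "R = Collect (reach cs (1, True))" and l: "reach cs l (neg l)"
  shows "l = (1, False)" "self_dual R" "Collect (reach cs l) = R"
proof -
  have "neg l \<in> R" if "l \<in> R"
    using that rtranclp_trans[OF _ l] unfolding R by simp
  with start show l1: "l = (1, False)" and sd: "self_dual R" by auto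
  have "(1, True) \<in> R" unfolding R by simp
  with sd have "neg (1, True) \<in> R" unfolding self_dual_def by (rule bspec)
  then have "reach cs (1, True) l" unfolding R l1 by simp
  moreover have "reach cs l (1, True)" using l unfolding l1 by simp
  ultimately have "reach cs l l' \<longleftrightarrow> reach cs (1, True) l'" for l' by (meson rtranclp_trans)
  then show "Collect (reach cs l) = R" unfolding R by blast
qed

lemma wp_algorithm_Or:
  assumes wf: "well_formed \<phi>" and conn: "conn \<phi> = Or"
  shows "wp algorithm (\<lambda>T' s'. T' \<le> 200 * (formula_length \<phi> + 1) \<and>
    (case answer_of s' of
       Not_PIC \<Rightarrow> \<not> possibility_integrity_constraint \<phi>
     | Is_Affine \<Rightarrow> affine \<phi>
     | Separation V1 V2 \<Rightarrow>
         separable \<phi> \<and> V1 \<subseteq> variables \<phi> \<and> V2 \<subseteq> variables \<phi> \<and>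
         V1 \<noteq> {} \<and> V2 \<noteq> {} \<and> V1 \<inter> V2 = {} \<and> no_common_clause \<phi> V1 V2
     | Renaming W \<Rightarrow>
         renamable_partially_horn \<phi> \<and> W \<subseteq> variables \<phi> \<and> partially_horn (rename W \<phi>)))
    0 (initial_state \<phi>)" (is "wp _ ?Q _ _")
proof -
  let ?cs = "clauses \<phi>" and ?E = "encode_formula \<phi>" and ?s0 = "initial_state \<phi>"
  let ?xs = "concat ?cs" and ?ids = "clause_ids 1 ?cs" and ?N = "formula_length \<phi>"
  let ?m = "length ?xs" and ?x = "(1, True) :: literal"
  have cs: "\<forall>C \<in> set ?cs. distinct C"
    using wf by (auto simp: well_formed_def distinct_map)
  have one: "1 \<in> variables \<phi>" using wf by (simp add: well_formed_def variables_def)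
  have m: "?m \<le> ?N"
    unfolding formula_length_def length_concat by (rule sum_list_mono) simp
  have cnf: "cnf \<phi>" using conn by (simp add: cnf_def)
  have B: "3 \<le> (20 :: nat)" by simp
  have E: "arr ?s0 0 = padded ?E" by (auto simp: initial_state_def padded_def)
  have z: "arr ?s0 a = (\<lambda>_. 0)" if "a \<noteq> 0" for a using that by (simp add: initial_state_def)
  have "wp scan (\<lambda>T' s'. T' \<le> 1 + 12 * ?N + 3 \<and> scanned ?xs ?ids s') 1 ?s0"
    unfolding formula_length_def
    by (rule wp_scan[OF E]) (auto simp: encode_formula_def padded_def z, simp add: initial_state_def)
  then have "wp scan (wp (Assign r_var (Const 1) ;; Assign r_sgn (Const 1) ;; search 10 ;; pick_start 10 ;;
    Assign r_var (Reg r_start_var) ;; Assign r_sgn (Reg r_start_sgn) ;; search 20 ;;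
    emit_negative 20 ;; conclude 20) ?Q) 1 ?s0"
  proof (rule wp_mono, elim conjE)
    fix T1 s1
    assume T1: "T1 \<le> 1 + 12 * ?N + 3" and sc1: "scanned ?xs ?ids s1" and fr1: "framed scan ?s0 s1"
    \<comment> \<open>The scan leaves the arrays of both searches at zero, as
      \<open>wp_search\<close> requires, and the input in array 0 intact.\<close>
    have arr1: "arr s1 a = arr ?s0 a" if "a \<notin> {3, 4, 5, 6, 7, 8}" for a
      using framed_arr[OF fr1] that by simp
    let ?s1 = "s1\<lparr>reg := (reg s1)(r_var := 1, r_sgn := 1)\<rparr>"
    have "scanned ?xs ?ids ?s1" using sc1 by (simp add: scanned_def)
    then have "wp (search 10) (\<lambda>T' s'. T' \<le> (T1 + 1 + 1) + 50 * ?m + 20 \<and> scanned ?xs ?ids s' \<and>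
      (\<exists>q. queue 10 q s' \<and> set q = Collect (reach ?cs ?x) \<and> length q \<le> 1 + ?m)) (T1 + 1 + 1) ?s1"
      by (intro wp_search cs) (auto simp: arr1 z)
    then have "wp (search 10) (wp (pick_start 10 ;;
      Assign r_var (Reg r_start_var) ;; Assign r_sgn (Reg r_start_sgn) ;; search 20 ;;
      emit_negative 20 ;; conclude 20) ?Q) (T1 + 1 + 1) ?s1"
    proof (rule wp_mono, elim conjE exE)
      fix T2 s2 q
      assume T2: "T2 \<le> (T1 + 1 + 1) + 50 * ?m + 20" and sc2: "scanned ?xs ?ids s2"
        and q: "queue 10 q s2" "set q = Collect (reach ?cs ?x)" "length q \<le> 1 + ?m"
        and fr2: "framed (search 10) ?s1 s2"
      have arr2: "arr s2 a = arr ?s0 a" if "a \<notin> {3, 4, 5, 6, 7, 8}" "a \<notin> {10, 11, 12, 13, 14}" for a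
        using framed_arr[OF fr2, of a] arr1 that by simp
      from wp_pick_start[OF q(1), of T2]
      show "wp (pick_start 10 ;;
        Assign r_var (Reg r_start_var) ;; Assign r_sgn (Reg r_start_sgn) ;; search 20 ;;
        emit_negative 20 ;; conclude 20) ?Q T2 s2"
        unfolding wp_Seq[of "pick_start 10"]
      proof (rule wp_mono, elim conjE exE)
        fix T3 s3 l
        assume T3: "T3 \<le> T2 + 13 * length q + 4"
          and l: "reg s3 r_start_var = fst l" "reg s3 r_start_sgn = of_bool (snd l)"
          and start: "l \<in> set q \<and> neg l \<notin> set q \<or> l = (1, False) \<and> self_dual (set q)"
          and fr3: "framed (pick_start 10) s2 s3"
        have arr3: "arr s3 a = arr s2 a" for a using framed_arr[OF fr3, of a] by simp
        let ?s3 = "s3\<lparr>reg := (reg s3)(r_var := fst l, r_sgn := of_bool (snd l))\<rparr>"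
        have "scanned ?xs ?ids s3" using scanned_framed[OF fr3 _ _ sc2] by simp
        then have "scanned ?xs ?ids ?s3" by (simp add: scanned_def)
        then have "wp (search 20) (\<lambda>T' s'. T' \<le> (T3 + 1 + 1) + 50 * ?m + 20 \<and> scanned ?xs ?ids s' \<and>
          (\<exists>q. queue 20 q s' \<and> set q = Collect (reach ?cs l) \<and> length q \<le> 1 + ?m)) (T3 + 1 + 1) ?s3"
          by (intro wp_search cs) (auto simp: arr3 arr2 z)
        then have "wp (search 20) (wp (emit_negative 20 ;; conclude 20) ?Q) (T3 + 1 + 1) ?s3"
        proof (rule wp_mono, elim conjE exE)
          fix T4 s4 p
          assume T4: "T4 \<le> (T3 + 1 + 1) + 50 * ?m + 20"
            and p: "queue 20 p s4" "set p = Collect (reach ?cs l)" "length p \<le> 1 + ?m"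
            and fr4: "framed (search 20) ?s3 s4"
          from wp_emit_negative[OF p(1) B, of T4]
          show "wp (emit_negative 20 ;; conclude 20) ?Q T4 s4"
            unfolding wp_Seq
          proof (rule wp_mono, elim conjE)
            fix T5 s5
            assume T5: "T5 \<le> T4 + 5 * length p + 3" and W: "listed_set s5 1 = {x. (x, False) \<in> set p}"
              and fr5: "framed (emit_negative 20) s4 s5"
            have p5: "queue 20 p s5" by (rule queue_framed[OF fr5 _ _ p(1)]) simp_all
            have l5: "reg s5 r_start_var = fst l" "reg s5 r_start_sgn = of_bool (snd l)"
              using l framed_reg[OF fr5] framed_reg[OF fr4] by simp_all
            have n: "arr s5 0 0 = nvars \<phi>"
              using framed_arr[OF fr5, of 0] framed_arr[OF fr4, of 0] arr3[of 0] arr2[of 0] E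
              by (simp add: encode_formula_def padded_def)
            from wp_conclude[OF p5 B l5, of T5]
            show "wp (conclude 20) ?Q T5 s5"
            proof (rule wp_mono, elim conjE)
              fix T6 s6
              assume T6: "T6 \<le> T5 + 2 * length p + 11" and fr6: "framed (conclude 20) s5 s6"
                and c: "if neg l \<notin> set p then reg s6 0 = 3
                  else (\<exists>y \<ge> 1. (y, False) \<notin> set p \<and> (\<forall>x. 1 \<le> x \<and> x < y \<longrightarrow> (x, False) \<in> set p) \<and>
                    (if arr s5 0 0 < y then reg s6 0 = 0 else reg s6 0 = 2 \<and> listed_set s6 2 = {y}))"
              have W6: "listed_set s6 1 = {x. reach ?cs l (x, False)}"
                using W framed_arr[OF fr6, of 1] framed_reg[OF fr6, of 1] p(2) by (simp add: listed_set_def)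
              have lV: "fst l \<in> variables \<phi>"
              proof (cases "l = (1, False)")
                case False
                then have "reach ?cs ?x l" using start q(2) by simp
                from reach_variables[OF wf _ this] one show ?thesis by simp
              qed (simp add: one[simplified])
              \<comment> \<open>The phases add up to at most 132 * \<open>?N\<close> + 86 steps,
                using that there are at most \<open>?N\<close> occurrences.\<close>
              have "T6 \<le> 200 * (?N + 1)"
                using T1 T2 T3 T4 T5 T6 q(3) p(3) m by simp
              moreover have "reg s6 0 = 3" if "neg l \<notin> set p" using c that by simp
              moreover note renaming_correct[OF wf cnf lV _ W6]
              ultimately show "?Q T6 s6"
              proof (cases "neg l \<in> set p")
                case True
                then have back_edge: "reach ?cs l (neg l)" using p(2) by simp
                note second = second_search[OF start q(2) back_edge]
                have l: "l = (1, False)" and sd: "self_dual (Collect (reach ?cs ?x))"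
                  and eq: "set p = Collect (reach ?cs ?x)"
                  using second p(2) q(2) by simp_all
                obtain y where y: "1 \<le> y" "(y, False) \<notin> set p" "\<forall>x. 1 \<le> x \<and> x < y \<longrightarrow> (x, False) \<in> set p"
                  "if nvars \<phi> < y then reg s6 0 = 0 else reg s6 0 = 2 \<and> listed_set s6 2 = {y}"
                  using c True n by auto
                show ?thesis
                proof (cases "nvars \<phi> < y")
                  case True
                  \<comment> \<open>The first unmarked number lies beyond the last variable, so the
                    first variable reaches all of them.\<close>
                  have "\<not> possibility_integrity_constraint \<phi>"
                  proof (rule not_pic[OF wf conn sd])
                    show "reach ?cs (neg ?x) ?x" using back_edge l by simp
                    show "\<forall>x \<in> variables \<phi>. reach ?cs ?x (x, False)"
                      using y(3) True unfolding eq variables_def by simp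
                  qed (simp add: one[simplified])
                  then show ?thesis using True y(4) \<open>T6 \<le> 200 * (?N + 1)\<close> by (simp add: answer_of_def)
                next
                  case False
                  have "separable \<phi> \<and> listed_set s6 1 \<subseteq> variables \<phi> \<and> {y} \<subseteq> variables \<phi> \<and>
                    listed_set s6 1 \<noteq> {} \<and> {y} \<noteq> {} \<and> listed_set s6 1 \<inter> {y} = {} \<and>
                    no_common_clause \<phi> (listed_set s6 1) {y}"
                  proof (rule separation_correct[OF wf p(2) lV])
                    show "self_dual (set p)" using sd eq by simp
                    show "y \<in> variables \<phi>" using y(1) False by (simp add: variables_def)
                    show "listed_set s6 1 = {x. (x, False) \<in> set p}" using W6 p(2) by simp
                  qed (rule y(2))
                  then show ?thesis using False y(4) \<open>T6 \<le> 200 * (?N + 1)\<close> by (simp add: answer_of_def)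
                qed
              qed (simp add: answer_of_def p(2))
            qed
          qed
        qed
        then show "wp (Assign r_var (Reg r_start_var) ;; Assign r_sgn (Reg r_start_sgn) ;; search 20 ;;
            emit_negative 20 ;; conclude 20) ?Q T3 s3"
          by (simp only: wp_Seq wp_Assign eval_expr.simps) (simp add: l)
      qed
    qed
    then show "wp (Assign r_var (Const 1) ;; Assign r_sgn (Const 1) ;; search 10 ;; pick_start 10 ;;
      Assign r_var (Reg r_start_var) ;; Assign r_sgn (Reg r_start_sgn) ;; search 20 ;;
      emit_negative 20 ;; conclude 20) ?Q T1 s1"
      by (simp only: wp_Seq wp_Assign eval_expr.simps) simp
  qed
  moreover have "\<not> eval_test (Equal (Read 0 (Const 1)) (Const 1)) ?s0"
    using E conn by (simp add: encode_formula_def padded_def)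
  ultimately show ?thesis
    unfolding algorithm_def by (simp only: wp_Cond wp_Seq[of scan] if_False add_0)
qed

theorem theorem3p4:
  "\<exists>(p :: program) (c :: nat). \<forall>\<phi> :: formula. well_formed \<phi> \<longrightarrow>
     (\<exists>t s. runs p (initial_state \<phi>) t s \<and> t \<le> c * (formula_length \<phi> + 1) \<and>
        (case answer_of s of
           Not_PIC \<Rightarrow> \<not> possibility_integrity_constraint \<phi>
         | Is_Affine \<Rightarrow> affine \<phi>
         | Separation V1 V2 \<Rightarrow>
             separable \<phi> \<and> V1 \<subseteq> variables \<phi> \<and> V2 \<subseteq> variables \<phi> \<and>
             V1 \<noteq> {} \<and> V2 \<noteq> {} \<and> V1 \<inter> V2 = {} \<and> no_common_clause \<phi> V1 V2
         | Renaming W \<Rightarrow>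
             renamable_partially_horn \<phi> \<and> W \<subseteq> variables \<phi> \<and> partially_horn (rename W \<phi>)))"
proof (rule exI[of _ algorithm], rule exI[of _ 200], intro allI impI)
  fix \<phi> assume wf: "well_formed \<phi>"
  let ?Q = "\<lambda>t s. t \<le> 200 * (formula_length \<phi> + 1) \<and>
    (case answer_of s of
       Not_PIC \<Rightarrow> \<not> possibility_integrity_constraint \<phi>
     | Is_Affine \<Rightarrow> affine \<phi>
     | Separation V1 V2 \<Rightarrow>
         separable \<phi> \<and> V1 \<subseteq> variables \<phi> \<and> V2 \<subseteq> variables \<phi> \<and>
         V1 \<noteq> {} \<and> V2 \<noteq> {} \<and> V1 \<inter> V2 = {} \<and> no_common_clause \<phi> V1 V2
     | Renaming W \<Rightarrow>
         renamable_partially_horn \<phi> \<and> W \<subseteq> variables \<phi> \<and> partially_horn (rename W \<phi>))"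
  have "wp algorithm ?Q 0 (initial_state \<phi>)"
  proof (cases "conn \<phi>")
    case Or
    then show ?thesis by (rule wp_algorithm_Or[OF wf])
  next
    case Xor
    \<comment> \<open>Two steps suffice, one test and one assignment, and the connective alone makes
      the formula affine.\<close>
    then show ?thesis
      by (simp add: algorithm_def initial_state_def encode_formula_def answer_of_def affine_def)
  qed
  then show "\<exists>t s. runs algorithm (initial_state \<phi>) t s \<and> ?Q t s"
    unfolding wp_def by simp
qed

end
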